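(* Let $b:\mathbb{R}\to\mathbb{R}$ be $T$-periodic ($T>0$), continuous, of bounded variation (on a period), with $b(t)>0$ for almost every $t$, and let $\beta=\frac1T\int_0^T b(t)\,dt$. For $\xi\in\mathbb{R}^n$ and $t\in\mathbb{R}$ let $\mathcal{M}(t,\xi)=\mathcal{E}(t+T,t,\xi)\in\mathbb{C}^{2\times2}$ be the monodromy matrix (defined in the context) of the equation $\hat u_{tt}+|\xi|^2\hat u+2b(t)\hat u_t=0$. Then: (1) There exists a (large) number $N>0$ such that for all $|\xi|\ge N$ the matrix $\mathcal{M}(t,\xi)$ is a contraction uniformly in $t$, i.e. $\sup_t\|\mathcal{M}(t,\xi)\|<1$. (2) With $N$ as in (1), for any (small) number $c>0$ there exists an exponent $k\in\mathbb{N}$ such that for all $\xi$ with $c\le|\xi|\le N$ the matrix $\mathcal{M}^k(t,\xi)$ is a contraction uniformly in $t$, i.e. $\sup_t\|\mathcal{M}^k(t,\xi)\|<1$. (3) There is a coefficient $\alpha_2>0$ such that, as $\xi\to0$, the two eigenvalues $\varkappa_1(\xi),\varkappa_2(\xi)$ of $\mathcal{M}(t,\xi)$ (suitably labelled) satisfy $$\log\varkappa_1(\xi)=-\alpha_2T|\xi|^2+\mathcal{O}(|\xi|^4),\qquad \log\varkappa_2(\xi)=-2\beta T+\alpha_2T|\xi|^2+\mathcal{O}(|\xi|^4).$$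
   Context: Set $D_t=-i\partial_t$ and $$A(t,\xi)=\begin{pmatrix}0&|\xi|\\|\xi|&2ib(t)\end{pmatrix}.$$ The equation $\hat u_{tt}+|\xi|^2\hat u+2b(t)\hat u_t=0$ is equivalent to the system $D_tV=A(t,\xi)V$ for $V=(|\xi|\hat u,D_t\hat u)^T$. The fundamental solution $\mathcal{E}(t,s,\xi)\in\mathbb{C}^{2\times2}$ is the matrix-valued solution of $D_t\mathcal{E}(t,s,\xi)=A(t,\xi)\mathcal{E}(t,s,\xi)$, $\mathcal{E}(s,s,\xi)=I$. The monodromy matrix is $\mathcal{M}(t,\xi)=\mathcal{E}(t+T,t,\xi)$; it is $T$-periodic in $t$, so $\sup_t$ may be taken over $t\in[0,T]$. Its eigenvalues do not depend on $t$. $\mathcal{M}^k(t,\xi)$ denotes the $k$-th matrix power, and $\|\cdot\|$ is the operator norm on $\mathbb{C}^{2\times2}$ induced by the Euclidean norm on $\mathbb{C}^2$. *)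

theory Defs
  imports "HOL-Analysis.Analysis" "HOL-Library.Landau_Symbols"
begin

definition bounded_variation_on :: "(real \<Rightarrow> real) \<Rightarrow> real \<Rightarrow> real \<Rightarrow> bool" where
  "bounded_variation_on f a c \<longleftrightarrow>
     (\<exists>B. \<forall>(m::nat) (x :: nat \<Rightarrow> real).
        x 0 = a \<and> x m = c \<and> (\<forall>i<m. x i \<le> x (Suc i)) \<longrightarrow>
        (\<Sum>i<m. \<bar>f (x (Suc i)) - f (x i)\<bar>) \<le> B)"

definition A_mat :: "(real \<Rightarrow> real) \<Rightarrow> real \<Rightarrow> real^'n \<Rightarrow> complex^2^2" where
  "A_mat b t \<xi> =
     vector [vector [0,                        complex_of_real (norm \<xi>)],
             vector [complex_of_real (norm \<xi>), 2 * \<i> * complex_of_real (b t)]]"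

text \<open>With \<open>D\<^sub>t = - \<i> \<partial>\<^sub>t\<close>, the system \<open>D\<^sub>t X = A X\<close> reads \<open>\<partial>\<^sub>t X = \<i> A X\<close>.\<close>

definition is_fundamental_solution ::
    "(real \<Rightarrow> real) \<Rightarrow> real \<Rightarrow> real^'n \<Rightarrow> (real \<Rightarrow> complex^2^2) \<Rightarrow> bool" where
  "is_fundamental_solution b s \<xi> X \<longleftrightarrow>
     X s = mat 1 \<and>
     (\<forall>t. (X has_vector_derivative (\<chi> i j. \<i> * (A_mat b t \<xi> ** X t) $ i $ j)) (at t))"

text \<open>For continuous \<open>b\<close> the linear initial value problem has exactly one solution on the
  whole real line, so the description below denotes it.\<close>

definition fundamental_solution ::
    "(real \<Rightarrow> real) \<Rightarrow> real \<Rightarrow> real \<Rightarrow> real^'n \<Rightarrow> complex^2^2" where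
  "fundamental_solution b t s \<xi> = (THE X. is_fundamental_solution b s \<xi> X) t"

definition monodromy :: "(real \<Rightarrow> real) \<Rightarrow> real \<Rightarrow> real \<Rightarrow> real^'n \<Rightarrow> complex^2^2" where
  "monodromy b T t \<xi> = fundamental_solution b (t + T) t \<xi>"

text \<open>The library's \<open>^\<close> and \<open>*\<close> on \<open>complex^2^2\<close> act entrywise, hence a separate matrix power.\<close>

primrec mat_power :: "complex^2^2 \<Rightarrow> nat \<Rightarrow> complex^2^2" where
  "mat_power M 0 = mat 1"
| "mat_power M (Suc k) = M ** mat_power M k"

definition op_norm :: "complex^2^2 \<Rightarrow> real" where
  "op_norm M = onorm (\<lambda>v. M *v v)"

text \<open>The supremum of an unbounded set of reals is an arbitrary value, hence the explicit
  boundedness.\<close>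

definition uniform_contraction :: "(real \<Rightarrow> complex^2^2) \<Rightarrow> bool" where
  "uniform_contraction F \<longleftrightarrow>
     bdd_above (range (\<lambda>t. op_norm (F t))) \<and> (SUP t. op_norm (F t)) < 1"

definition eigenvalues :: "complex^2^2 \<Rightarrow> complex set" where
  "eigenvalues M = {z. \<exists>v. v \<noteq> 0 \<and> M *v v = z *s v}"

end

theory Submission
  imports Defs
begin

text \<open>
The contraction statements rest on the energy identity. The system \<open>\<partial>\<^sub>t V = \<i> A V\<close> conserves
\<open>\<parallel>V\<parallel>\<^sup>2\<close> except for the dissipation, which removes \<open>4 b \<bar>V\<^sub>2\<bar>\<^sup>2\<close> per unit time. A solution that
loses nothing over a whole period has \<open>V\<^sub>2 = 0\<close> wherever \<open>b > 0\<close>; the second equation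
\<open>V\<^sub>2' = \<i> \<bar>\<xi>\<bar> V\<^sub>1 - 2 b V\<^sub>2\<close> then gives \<open>\<bar>\<xi>\<bar> V\<^sub>1 = 0\<close> as well. So for every \<open>\<xi> \<noteq> 0\<close> each nonzero
solution loses energy over each period (\<open>energy_strict_decay\<close>), and compactness of a period and of the
unit sphere makes the loss uniform (\<open>uniform_energy_decay\<close>). Thus the monodromy matrix itself is
already a uniform contraction for each \<open>\<xi> \<noteq> 0\<close> (\<open>monodromy_contraction\<close>), which yields the assertion
on large frequencies with \<open>N = 1\<close>, and the one on intermediate frequencies with \<open>k = 1\<close>.

The expansion at small frequencies is computed from trace and determinant. By Liouville's formula the
determinant is \<open>\<delta> = exp (-2 \<beta> T)\<close> (\<open>det_monodromy\<close>). Removing the dissipative term by the integrating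
factor \<open>exp (2 \<integral>b)\<close> and iterating the resulting pair of integral equations shows
\<open>tr = 1 + \<delta> - a \<bar>\<xi>\<bar>\<^sup>2 + O(\<bar>\<xi>\<bar>\<^sup>4)\<close> with a positive \<open>a\<close>
(\<open>trace_monodromy_expansion\<close>). As \<open>\<delta> \<noteq> 1\<close>, the two roots of the characteristic polynomial separate,
and solving it perturbatively (\<open>log_of_quadratic_roots_expansion\<close>) gives
\<open>log \<kappa>\<^sub>1 = - a / (1 - \<delta>) \<bar>\<xi>\<bar>\<^sup>2 + O(\<bar>\<xi>\<bar>\<^sup>4)\<close>, while \<open>\<kappa>\<^sub>1 \<kappa>\<^sub>2 = \<delta>\<close> gives
the other logarithm. So \<open>\<alpha>\<^sub>2 = a / (T (1 - \<delta>))\<close>.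

Existence and uniqueness of solutions of linear differential equations, on which the
meaning of the fundamental solution depends, are established for general coefficients
(\<open>linear_ode_exists\<close>, \<open>linear_ode_unique\<close>).
\<close>

section \<open>Linear differential equations with bounded coefficients\<close>

lemma antiderivative_exists:
  fixes f :: "real \<Rightarrow> 'a::euclidean_space"
  assumes "continuous_on UNIV f"
  shows "\<exists>F. F s = 0 \<and> (\<forall>t. (F has_vector_derivative f t) (at t))"
proof -
  have "\<exists>F. \<forall>x::real. - \<infinity> < ereal x \<longrightarrow> ereal x < \<infinity> \<longrightarrow> (F has_vector_derivative f x) (at x)"
    by (rule einterval_antiderivative)
      (use assms in \<open>auto simp: continuous_on_eq_continuous_at\<close>)
  then obtain F where F: "\<And>t. (F has_vector_derivative f t) (at t)"
    by auto
  have "((\<lambda>t. F t - F s) has_vector_derivative f t) (at t)" for t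
    using has_vector_derivative_diff[OF F[of t] has_vector_derivative_const[of "F s"]] by simp
  then show ?thesis
    by (intro exI[of _ "\<lambda>t. F t - F s"]) simp
qed

lemma has_vector_derivative_continuous_on:
  assumes "\<And>t. (F has_vector_derivative f t) (at t)"
  shows "continuous_on S F"
  by (meson assms continuous_at_imp_continuous_on has_vector_derivative_continuous)

text \<open>One step of the Picard iteration gains a power of the distance to the initial time together with
the matching factorial denominator. Integrating the bound gives the estimate to the right of \<open>s\<close>;
the half-line to the left is reached by reflection.\<close>
lemma antiderivative_power_bound:
  fixes F f :: "real \<Rightarrow> 'a::real_normed_vector"
  assumes F: "\<And>t. (F has_vector_derivative f t) (at t)" and "F s = 0"
    and bound: "\<And>t. norm (f t) \<le> C * \<bar>t - s\<bar> ^ n"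
  shows "norm (F t) \<le> C * \<bar>t - s\<bar> ^ Suc n / real (Suc n)"
proof -
  have one_sided: "norm (F (s + \<sigma> * u)) \<le> C * u ^ Suc n / real (Suc n)"
    if "u > 0" and \<sigma>: "\<bar>\<sigma>\<bar> = 1" for u \<sigma> :: real
  proof -
    let ?G = "\<lambda>u. F (s + \<sigma> * u)" and ?\<phi> = "\<lambda>u. C * u ^ Suc n / real (Suc n)"
    have G: "(?G has_vector_derivative \<sigma> *\<^sub>R f (s + \<sigma> * v)) (at v)" for v
    proof -
      have "((\<lambda>u. s + \<sigma> * u) has_vector_derivative \<sigma>) (at v)"
        by (auto intro!: derivative_eq_intros simp flip: has_real_derivative_iff_has_vector_derivative)
      from vector_diff_chain_at[OF this F] show ?thesis by (simp add: o_def)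
    qed
    have phi: "(?\<phi> has_vector_derivative C * v ^ n) (at v)" for v
      unfolding has_real_derivative_iff_has_vector_derivative[symmetric]
      by (rule derivative_eq_intros refl | simp)+
    have "norm (?G u - ?G 0) \<le> ?\<phi> u - ?\<phi> 0"
    proof (rule differentiable_bound_general[OF \<open>u > 0\<close> _ _ G phi])
      show "continuous_on {0..u} ?G" by (rule has_vector_derivative_continuous_on[OF G])
      show "continuous_on {0..u} ?\<phi>" by (intro continuous_intros) simp
      fix v :: real assume "0 < v" "v < u"
      then show "norm (\<sigma> *\<^sub>R f (s + \<sigma> * v)) \<le> C * v ^ n"
        using bound[of "s + \<sigma> * v"] \<sigma> by (simp add: abs_mult)
    qed
    then show ?thesis using \<open>F s = 0\<close> by simp
  qed
  consider "t = s" | "t > s" | "t < s" by linarith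
  then show ?thesis
  proof cases
    case 1 then show ?thesis using \<open>F s = 0\<close> by simp
  next
    case 2 then show ?thesis using one_sided[of "t - s" 1] by simp
  next
    case 3 then show ?thesis using one_sided[of "s - t" "-1"] by simp
  qed
qed

text \<open>The solution is the Neumann series of the iterated antiderivatives of
\<open>t \<mapsto> A t (x t)\<close>. Its terms are bounded by those of the exponential series of
\<open>L \<bar>t - s\<bar>\<close>, so it may be differentiated term by term on every ball around \<open>s\<close>.
The balls exhaust the line, so the solution is global.\<close>
lemma linear_ode_exists:
  fixes A :: "real \<Rightarrow> 'a::euclidean_space \<Rightarrow> 'a"
  assumes lin: "\<And>t. linear (A t)"
    and cont: "continuous_on UNIV (\<lambda>(t, x). A t x)"
    and bound: "\<And>t x. norm (A t x) \<le> L * norm x"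
  shows "\<exists>X. X s = x0 \<and> (\<forall>t. (X has_vector_derivative A t (X t)) (at t))"
proof -
  define prim where "prim f = (SOME F. F s = 0 \<and> (\<forall>t. (F has_vector_derivative f t) (at t)))"
    for f :: "real \<Rightarrow> 'a"
  have prim: "prim f s = 0" "(prim f has_vector_derivative f t) (at t)"
    if "continuous_on UNIV f" for f t
    using someI_ex[OF antiderivative_exists[OF that, of s]] by (auto simp: prim_def)
  define x where "x = rec_nat (\<lambda>_. x0) (\<lambda>n y. prim (\<lambda>t. A t (y t)))"
  have x_simps: "x 0 = (\<lambda>_. x0)" "x (Suc n) = prim (\<lambda>t. A t (x n t))" for n
    by (simp_all add: x_def)
  have cont_A: "continuous_on UNIV (\<lambda>t. A t (y t))" if "continuous_on UNIV y" for y
    using continuous_on_compose2[OF cont continuous_on_Pair[OF continuous_on_id that]] by simp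
  have cont_x: "continuous_on UNIV (x n)" for n
  proof (induction n)
    case 0 show ?case by (simp add: x_simps)
  next
    case (Suc n)
    show ?case unfolding x_simps
      by (rule has_vector_derivative_continuous_on[OF prim(2)[OF cont_A[OF Suc]]])
  qed
  \<comment> \<open>The series of derivatives is the series of images under \<open>A\<close>, delayed by one index.\<close>
  define d where "d n t = (case n of 0 \<Rightarrow> 0 | Suc m \<Rightarrow> A t (x m t))" for n t
  have x_deriv: "(x n has_vector_derivative d n t) (at t)" for n t
    using prim(2)[OF cont_A[OF cont_x]] by (cases n) (auto simp: x_simps d_def)
  have x_s: "x n s = (if n = 0 then x0 else 0)" for n
    using prim(1)[OF cont_A[OF cont_x]] by (cases n) (auto simp: x_simps)
  have "L \<ge> 0"
    using bound[of 0 "SOME i. i \<in> Basis"] nonempty_Basis norm_ge_zero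
    by (metis mult.right_neutral norm_Basis order_trans some_in_eq)
  have x_bound: "norm (x n t) \<le> norm x0 * (L * \<bar>t - s\<bar>) ^ n / fact n" for n t
  proof (induction n arbitrary: t)
    case 0 show ?case by (simp add: x_simps)
  next
    case (Suc n)
    have "norm (x (Suc n) t) \<le> (L * norm x0 * L ^ n / fact n) * \<bar>t - s\<bar> ^ Suc n / real (Suc n)"
    proof (rule antiderivative_power_bound[where f = "\<lambda>t. A t (x n t)"])
      show "(x (Suc n) has_vector_derivative A t (x n t)) (at t)" for t
        using x_deriv[of "Suc n" t] by (simp add: d_def)
      show "x (Suc n) s = 0" by (simp add: x_s)
      fix t
      have "norm (A t (x n t)) \<le> L * (norm x0 * (L * \<bar>t - s\<bar>) ^ n / fact n)"
        using bound[of t "x n t"] mult_left_mono[OF Suc \<open>L \<ge> 0\<close>] by (rule order_trans)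
      then show "norm (A t (x n t)) \<le> (L * norm x0 * L ^ n / fact n) * \<bar>t - s\<bar> ^ n"
        by (simp add: power_mult_distrib mult_ac)
    qed
    then show ?case by (simp add: power_mult_distrib mult_ac)
  qed
  define X where "X t = (\<Sum>n. x n t)" for t
  have summable_x: "summable (\<lambda>n. x n t)" for t
  proof (rule summable_comparison_test')
    show "summable (\<lambda>n. norm x0 * ((L * \<bar>t - s\<bar>) ^ n / fact n))"
      using summable_exp_generic[of "L * \<bar>t - s\<bar>"] by (intro summable_mult) (simp add: field_simps)
  qed (use x_bound in auto)
  have sums_d: "(\<Sum>n. d n t) = A t (X t)" for t
  proof -
    have "(\<lambda>n. A t (x n t)) sums A t (X t)"
      unfolding X_def using lin[of t] linear_conv_bounded_linear
      by (intro bounded_linear.sums[of "A t"] summable_sums summable_x) auto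
    then have "(\<lambda>n. d (Suc n) t) sums A t (X t)" by (simp add: d_def)
    then have "(\<lambda>n. d n t) sums (A t (X t) + d 0 t)" by (rule sums_Suc)
    then show ?thesis by (simp add: d_def sums_iff)
  qed
  have X_deriv: "(X has_vector_derivative A t (X t)) (at t)" for t
  proof -
    define R where "R = \<bar>t - s\<bar> + 1"
    let ?S = "ball s R"
    define M where "M n = (case n of 0 \<Rightarrow> 0 | Suc m \<Rightarrow> L * (norm x0 * ((L * R) ^ m / fact m)))" for n
    have "summable M"
    proof -
      have "summable (\<lambda>n. L * (norm x0 * ((L * R) ^ n / fact n)))"
        using summable_exp_generic[of "L * R"] by (intro summable_mult) (simp add: field_simps)
      then have "summable (\<lambda>n. M (Suc n))" by (simp add: M_def)
      then show ?thesis using summable_Suc_iff by blast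
    qed
    moreover have "norm (d n u) \<le> M n" if "u \<in> ?S" for n u
    proof (cases n)
      case (Suc m)
      have "norm (A u (x m u)) \<le> L * (norm x0 * (L * \<bar>u - s\<bar>) ^ m / fact m)"
        using bound[of u "x m u"] mult_left_mono[OF x_bound \<open>L \<ge> 0\<close>] by (rule order_trans)
      also have "\<dots> \<le> L * (norm x0 * (L * R) ^ m / fact m)"
        using that \<open>L \<ge> 0\<close>
        by (intro mult_left_mono divide_right_mono power_mono) (auto simp: dist_real_def)
      finally show ?thesis by (simp add: Suc d_def M_def)
    qed (simp add: d_def M_def)
    ultimately have "uniform_limit ?S (\<lambda>n u. \<Sum>i<n. d i u) (\<lambda>u. \<Sum>i. d i u) sequentially"
      by (intro Weierstrass_m_test) auto
    then have unif: "uniform_limit ?S (\<lambda>n u. \<Sum>i<n. d i u) (\<lambda>u. A u (X u)) sequentially"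
      by (simp add: sums_d)
    have "\<exists>g. \<forall>u\<in>?S. (\<lambda>n. x n u) sums g u
            \<and> (g has_derivative (\<lambda>h. h *\<^sub>R A u (X u))) (at u within ?S)"
    proof (rule has_derivative_series)
      show "(x n has_derivative (\<lambda>h. h *\<^sub>R d n u)) (at u within ?S)" for n u
        using x_deriv[of n u] has_derivative_at_withinI unfolding has_vector_derivative_def by blast
      show "s \<in> ?S" by (simp add: R_def)
      show "(\<lambda>n. x n s) sums X s" unfolding X_def by (rule summable_sums[OF summable_x])
      fix e :: real assume "e > 0"
      with unif have "\<forall>\<^sub>F n in sequentially. \<forall>u\<in>?S. dist (\<Sum>i<n. d i u) (A u (X u)) < e"
        by (rule uniform_limitD)
      then show "\<forall>\<^sub>F n in sequentially. \<forall>u\<in>?S. \<forall>h.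
          norm ((\<Sum>i<n. h *\<^sub>R d i u) - h *\<^sub>R A u (X u)) \<le> e * norm h"
      proof eventually_elim
        case (elim n)
        show ?case
        proof (intro ballI allI)
          fix u h assume "u \<in> ?S"
          then have "norm ((\<Sum>i<n. d i u) - A u (X u)) \<le> e"
            using bspec[OF elim \<open>u \<in> ?S\<close>] by (simp only: dist_norm less_imp_le)
          then have "\<bar>h\<bar> * norm ((\<Sum>i<n. d i u) - A u (X u)) \<le> \<bar>h\<bar> * e"
            by (intro mult_left_mono) auto
          then show "norm ((\<Sum>i<n. h *\<^sub>R d i u) - h *\<^sub>R A u (X u)) \<le> e * norm h"
            by (simp flip: scaleR_sum_right scaleR_diff_right add: mult.commute)
        qed
      qed
    qed auto
    then obtain g where g: "\<And>u. u \<in> ?S \<Longrightarrow> (\<lambda>n. x n u) sums g u"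
      "\<And>u. u \<in> ?S \<Longrightarrow> (g has_derivative (\<lambda>h. h *\<^sub>R A u (X u))) (at u within ?S)" by blast
    have t: "t \<in> ?S" by (simp add: R_def dist_real_def)
    have "(X has_derivative (\<lambda>h. h *\<^sub>R A t (X t))) (at t within ?S)"
      by (rule has_derivative_transform[OF t _ g(2)[OF t]])
        (simp only: X_def sums_unique[OF g(1)])
    then show ?thesis
      unfolding has_vector_derivative_def at_within_open[OF t open_ball] .
  qed
  have "X s = x0"
    using suminf_finite[of "{0}" "\<lambda>n. x n s"] by (simp add: X_def x_s)
  with X_deriv show ?thesis by blast
qed

text \<open>For the difference \<open>Z\<close> of two solutions, \<open>\<parallel>Z\<parallel>\<^sup>2\<close> can grow or decay at most at the
exponential rate \<open>2 L\<close>. Weighted by the growing exponential it is nondecreasing, by the decaying one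
nonincreasing; hence a zero at \<open>s\<close> propagates in both time directions.\<close>
lemma linear_ode_unique:
  fixes A :: "real \<Rightarrow> 'a::real_inner \<Rightarrow> 'a"
  assumes lin: "\<And>t. linear (A t)"
    and bound: "\<And>t x. norm (A t x) \<le> L * norm x"
    and X: "\<And>t. (X has_vector_derivative A t (X t)) (at t)"
    and Y: "\<And>t. (Y has_vector_derivative A t (Y t)) (at t)"
    and "X s = Y s"
  shows "X t = Y t"
proof -
  define Z where "Z t = X t - Y t" for t
  have Z: "(Z has_vector_derivative A t (Z t)) (at t)" for t
    unfolding Z_def linear_diff[OF lin] by (intro has_vector_derivative_diff X Y)
  \<comment> \<open>\<open>\<sigma> = 1\<close> serves the times before \<open>s\<close>, \<open>\<sigma> = -1\<close> the times after.\<close>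
  define E where "E \<sigma> t = exp (2 * \<sigma> * L * t) * (Z t \<bullet> Z t)" for \<sigma> t
  have E: "(E \<sigma> has_real_derivative 2 * exp (2 * \<sigma> * L * t) * (\<sigma> * L * (Z t \<bullet> Z t) + Z t \<bullet> A t (Z t))) (at t)"
    for \<sigma> t
  proof -
    have "((\<lambda>t. Z t \<bullet> Z t) has_real_derivative 2 * (Z t \<bullet> A t (Z t))) (at t)"
      unfolding has_real_derivative_iff_has_vector_derivative has_vector_derivative_def
      using has_derivative_inner[OF Z[unfolded has_vector_derivative_def, of t]
          Z[unfolded has_vector_derivative_def, of t]]
      by (simp add: inner_commute algebra_simps)
    then show ?thesis unfolding E_def
      by (auto intro!: derivative_eq_intros simp: algebra_simps)
  qed
  have inner_bound: "\<bar>Z t \<bullet> A t (Z t)\<bar> \<le> L * (Z t \<bullet> Z t)" for t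
  proof -
    have "\<bar>Z t \<bullet> A t (Z t)\<bar> \<le> norm (Z t) * norm (A t (Z t))" by (rule Cauchy_Schwarz_ineq2)
    also have "\<dots> \<le> norm (Z t) * (L * norm (Z t))" by (intro mult_left_mono bound) auto
    finally show ?thesis by (simp add: dot_square_norm power2_eq_square mult_ac)
  qed
  have E_s: "E \<sigma> s = 0" for \<sigma> using \<open>X s = Y s\<close> by (simp add: E_def Z_def)
  have "E 1 t \<le> E 1 s" if "t \<le> s"
  proof (rule DERIV_nonneg_imp_nondecreasing[OF that])
    fix u show "\<exists>y. DERIV (E 1) u :> y \<and> y \<ge> 0"
      using inner_bound[of u] E[of 1 u] by (auto intro!: exI)
  qed
  moreover have "E (-1) t \<le> E (-1) s" if "s \<le> t"
  proof (rule DERIV_nonpos_imp_nonincreasing[OF that])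
    fix u show "\<exists>y. DERIV (E (-1)) u :> y \<and> y \<le> 0"
      using inner_bound[of u] E[of "-1" u] by (auto intro!: exI simp: mult_le_0_iff)
  qed
  ultimately have "exp (2 * L * t) * (Z t \<bullet> Z t) \<le> 0 \<or> exp (- 2 * L * t) * (Z t \<bullet> Z t) \<le> 0"
    unfolding E_s by (cases "t \<le> s") (auto simp: E_def)
  then have "Z t \<bullet> Z t \<le> 0" by (auto simp: mult_le_0_iff not_less[symmetric] simp del: inner_gt_zero_iff)
  then have "Z t \<bullet> Z t = 0" by (rule antisym[OF _ inner_ge_zero])
  then show ?thesis by (simp add: Z_def)
qed

section \<open>Modes and their transport by the fundamental solution\<close>

lemma has_vector_derivative_vec_iff:
  fixes V :: "real \<Rightarrow> 'a::euclidean_space^'n"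
  shows "(V has_vector_derivative v) (at t) \<longleftrightarrow>
    (\<forall>i. ((\<lambda>t. V t $ i) has_vector_derivative v $ i) (at t))"
proof
  assume "(V has_vector_derivative v) (at t)"
  then show "\<forall>i. ((\<lambda>t. V t $ i) has_vector_derivative v $ i) (at t)"
    using bounded_linear.has_vector_derivative[OF bounded_linear_vec_nth] by blast
next
  assume *: "\<forall>i. ((\<lambda>t. V t $ i) has_vector_derivative v $ i) (at t)"
  show "(V has_vector_derivative v) (at t)"
    unfolding has_vector_derivative_def has_derivative_componentwise_within[of V]
  proof
    fix k :: "'a^'n" assume "k \<in> Basis"
    then obtain i u where k: "k = axis i u" by (auto simp: Basis_vec_def)
    have "((\<lambda>t. V t $ i) has_derivative (\<lambda>h. h *\<^sub>R v $ i)) (at t)"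
      using * by (simp add: has_vector_derivative_def)
    from has_derivative_inner_left[OF this, of u]
    show "((\<lambda>t. V t \<bullet> k) has_derivative (\<lambda>h. (h *\<^sub>R v) \<bullet> k)) (at t)"
      by (simp add: k inner_axis)
  qed
qed

text \<open>The right-hand side of \<open>\<partial>\<^sub>t V = \<i> A V\<close> for a single vector; a mode depends on the frequency
only through its length \<open>r\<close>.\<close>
definition mode_field :: "(real \<Rightarrow> real) \<Rightarrow> real \<Rightarrow> real \<Rightarrow> complex^2 \<Rightarrow> complex^2" where
  "mode_field b r t v =
     vector [\<i> * complex_of_real r * v $ 2,
             \<i> * complex_of_real r * v $ 1 - 2 * complex_of_real (b t) * v $ 2]"

lemma mode_field_nth [simp]:
  "mode_field b r t v $ 1 = \<i> * complex_of_real r * v $ 2"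
  "mode_field b r t v $ 2 = \<i> * complex_of_real r * v $ 1 - 2 * complex_of_real (b t) * v $ 2"
  by (simp_all add: mode_field_def)

text \<open>This form exposes continuity in \<open>t\<close> and \<open>v\<close>, which is checked componentwise.\<close>
lemma mode_field_lambda:
  "mode_field b r t v = (\<chi> i. if i = 1 then \<i> * complex_of_real r * v $ 2
     else \<i> * complex_of_real r * v $ 1 - 2 * complex_of_real (b t) * v $ 2)"
  by (simp add: vec_eq_iff forall_2)

definition mode_solution :: "(real \<Rightarrow> real) \<Rightarrow> real \<Rightarrow> (real \<Rightarrow> complex^2) \<Rightarrow> bool" where
  "mode_solution b r V \<longleftrightarrow> (\<forall>t. (V has_vector_derivative mode_field b r t (V t)) (at t))"

lemma mode_solution_nth:
  assumes "mode_solution b r V"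
  shows "((\<lambda>t. V t $ 1) has_vector_derivative \<i> * complex_of_real r * V t $ 2) (at t)"
    and "((\<lambda>t. V t $ 2) has_vector_derivative
           \<i> * complex_of_real r * V t $ 1 - 2 * complex_of_real (b t) * V t $ 2) (at t)"
  using assms unfolding mode_solution_def has_vector_derivative_vec_iff forall_2 by simp_all

lemma mode_solution_continuous: "mode_solution b r V \<Longrightarrow> continuous_on S V"
  unfolding mode_solution_def by (rule has_vector_derivative_continuous_on) blast

lemma linear_mode_field: "linear (mode_field b r t)"
  by (rule linearI) (simp_all add: vec_eq_iff forall_2 algebra_simps)

lemma mode_field_scale: "mode_field b r t (c *s v) = c *s mode_field b r t v"
  by (simp add: vec_eq_iff forall_2 algebra_simps)

lemma mode_solution_add:
  "mode_solution b r V \<Longrightarrow> mode_solution b r W \<Longrightarrow> mode_solution b r (\<lambda>t. V t + W t)"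
  unfolding mode_solution_def linear_add[OF linear_mode_field]
  by (intro allI has_vector_derivative_add) auto

lemma mode_solution_scale:
  assumes "mode_solution b r V"
  shows "mode_solution b r (\<lambda>t. c *s V t)"
  unfolding mode_solution_def mode_field_scale has_vector_derivative_vec_iff
  using assms[unfolded mode_solution_def has_vector_derivative_vec_iff]
  by (auto intro!: derivative_eq_intros)

lemma norm_mode_field_le: "norm (mode_field b r t v) \<le> (2 * \<bar>r\<bar> + 2 * \<bar>b t\<bar>) * norm v"
proof -
  have "norm (mode_field b r t v) \<le> (\<Sum>i\<in>UNIV. norm (mode_field b r t v $ i))"
    unfolding norm_vec_def by (rule L2_set_le_sum) simp
  also have "\<dots> \<le> \<bar>r\<bar> * norm (v $ 2) + (\<bar>r\<bar> * norm (v $ 1) + 2 * \<bar>b t\<bar> * norm (v $ 2))"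
    unfolding sum_2 mode_field_nth
    by (intro add_mono norm_triangle_le_diff) (simp_all add: norm_mult)
  also have "\<dots> \<le> \<bar>r\<bar> * norm v + (\<bar>r\<bar> * norm v + 2 * \<bar>b t\<bar> * norm v)"
    by (intro add_mono mult_left_mono component_le_norm_cart Finite_Cartesian_Product.norm_nth_le) auto
  finally show ?thesis by (simp add: algebra_simps)
qed

lemma is_fundamental_solution_iff_columns:
  "is_fundamental_solution b s \<xi> X \<longleftrightarrow>
     (\<forall>j. mode_solution b (norm \<xi>) (\<lambda>t. column j (X t)) \<and> column j (X s) = axis j 1)"
proof -
  have init: "X s = mat 1 \<longleftrightarrow> (\<forall>j. column j (X s) = axis j 1)"
    by (auto simp: vec_eq_iff mat_def column_def axis_def)
  have "(\<chi> i j. \<i> * (A_mat b t \<xi> ** X t) $ i $ j) $ i $ j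
      = mode_field b (norm \<xi>) t (column j (X t)) $ i" for i j t
    using exhaust_2[of i]
    by (auto simp: A_mat_def matrix_matrix_mult_def sum_2 column_def algebra_simps)
  then have deriv: "(X has_vector_derivative (\<chi> i j. \<i> * (A_mat b t \<xi> ** X t) $ i $ j)) (at t) \<longleftrightarrow>
      (\<forall>j. ((\<lambda>t. column j (X t)) has_vector_derivative mode_field b (norm \<xi>) t (column j (X t))) (at t))"
    for t
    unfolding has_vector_derivative_vec_iff by (simp only: column_def vec_lambda_beta) blast
  show ?thesis
    unfolding is_fundamental_solution_def mode_solution_def init deriv by auto
qed

text \<open>The conditions on the dissipation that drive all three assertions: periodicity lets
estimates over one period be propagated to all times, and positivity almost everywhere makes
the energy decay over every period.\<close>
locale periodic_dissipation =
  fixes b :: "real \<Rightarrow> real" and T :: real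
  assumes T_pos: "T > 0"
    and periodic: "\<And>t. b (t + T) = b t"
    and cont: "continuous_on UNIV b"
    and pos: "AE t in lebesgue. b t > 0"
begin

text \<open>Positivity almost everywhere is turned into positivity somewhere in each open interval: the exceptional
null set contains no nonempty open set. By continuity this also excludes negative values.\<close>
lemma exists_pos_in_open:
  assumes "open S" "S \<noteq> {}"
  shows "\<exists>t\<in>S. b t > 0"
proof (rule ccontr)
  assume none: "\<not> ?thesis"
  obtain N where N: "N \<in> null_sets lebesgue" "{t \<in> space lebesgue. \<not> b t > 0} \<subseteq> N"
    using pos unfolding eventually_ae_filter by blast
  have "S \<subseteq> N" using none N(2) by auto
  then have "negligible S"
    using negligible_subset[OF N(1)[folded negligible_iff_null_sets]] by simp
  then show False using open_not_negligible[OF assms] by blast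
qed

lemma b_nonneg: "0 \<le> b t"
proof (rule ccontr)
  assume "\<not> 0 \<le> b t"
  have "open {t. b t < 0}"
    using cont by (intro open_Collect_less) auto
  then have "\<exists>u\<in>{t. b t < 0}. b u > 0"
    by (rule exists_pos_in_open) (use \<open>\<not> 0 \<le> b t\<close> in \<open>auto simp: not_le\<close>)
  then show False by auto
qed

lemma periodic_reduce:
  assumes "\<And>t. f (t + T) = f t"
  obtains t' where "t' \<in> {0..T}" "f t = f t'"
proof -
  interpret periodic_fun_simple f T by unfold_locales (rule assms)
  define n where "n = \<lfloor>t / T\<rfloor>"
  have "of_int n \<le> t / T" "t / T < of_int n + 1" unfolding n_def by linarith+
  then have "of_int n * T \<le> t" "t < (of_int n + 1) * T"
    using T_pos by (simp_all only: pos_le_divide_eq pos_divide_less_eq)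
  then have "t - of_int n * T \<in> {0..T}" by (simp add: distrib_right)
  then show ?thesis using that[of "t - of_int n * T"] minus_of_int[of t n] by simp
qed

lemma b_bounded: "\<exists>K. \<forall>t. \<bar>b t\<bar> \<le> K"
proof -
  have "compact (b ` {0..T})"
    using cont continuous_on_subset by (intro compact_continuous_image) blast+
  then have "bounded (b ` {0..T})" by (rule compact_imp_bounded)
  then obtain K where K: "\<And>t. t \<in> {0..T} \<Longrightarrow> \<bar>b t\<bar> \<le> K"
    unfolding bounded_iff by (metis imageI real_norm_def)
  have "\<bar>b t\<bar> \<le> K" for t
    by (rule periodic_reduce[of b, OF periodic, of t]) (use K in auto)
  then show ?thesis by blast
qed

lemma mode_field_bounded: "\<exists>L. \<forall>t v. norm (mode_field b r t v) \<le> L * norm v"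
proof -
  obtain K where K: "\<And>t. \<bar>b t\<bar> \<le> K" using b_bounded by blast
  have "norm (mode_field b r t v) \<le> (2 * \<bar>r\<bar> + 2 * K) * norm v" for t v
    using norm_mode_field_le[of b r t v] K[of t]
    by (elim order_trans) (intro mult_right_mono, auto)
  then show ?thesis by blast
qed

lemma mode_solution_exists: obtains V where "mode_solution b r V" "V s = v"
proof -
  obtain L where L: "\<And>t v. norm (mode_field b r t v) \<le> L * norm v"
    using mode_field_bounded[of r] by blast
  have "continuous_on UNIV (\<lambda>p :: real \<times> (complex^2). b (fst p))"
    by (rule continuous_on_compose2[OF cont]) (auto intro: continuous_intros)
  then have "continuous_on UNIV (\<lambda>p :: real \<times> (complex^2). if i = 1 then \<i> * complex_of_real r * snd p $ 2
      else \<i> * complex_of_real r * snd p $ 1 - 2 * complex_of_real (b (fst p)) * snd p $ 2)"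
    for i :: 2
    by (cases "i = 1") (auto intro!: continuous_intros)
  then have "continuous_on UNIV (\<lambda>(t, v). mode_field b r t v)"
    unfolding case_prod_beta mode_field_lambda by (rule continuous_on_vec_lambda)
  from linear_ode_exists[where A = "mode_field b r", OF linear_mode_field this L, of s v] obtain V
    where "V s = v" "mode_solution b r V" unfolding mode_solution_def by blast
  then show ?thesis using that by blast
qed

lemma mode_solution_unique:
  assumes "mode_solution b r V" "mode_solution b r W" "V s = W s"
  shows "V t = W t"
proof -
  obtain L where "\<And>t v. norm (mode_field b r t v) \<le> L * norm v" 
    using mode_field_bounded[of r] by blast
  from linear_ode_unique[where A = "mode_field b r", OF linear_mode_field this, of V W s t] assms show ?thesis
    by (simp add: mode_solution_def)
qed

lemma mode_solution_shift:
  assumes V: "mode_solution b r V" and c: "\<And>t. b (t + c) = b t"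
  shows "mode_solution b r (\<lambda>t. V (t + c))"
  unfolding mode_solution_def
proof
  fix t
  have "((\<lambda>t. t + c) has_vector_derivative 1) (at t)"
    by (auto intro!: derivative_eq_intros simp flip: has_real_derivative_iff_has_vector_derivative)
  moreover have "mode_field b r (t + c) = mode_field b r t"
    by (rule ext) (simp add: mode_field_def c)
  then have "(V has_vector_derivative mode_field b r t (V (t + c))) (at (t + c))"
    using V[unfolded mode_solution_def, rule_format, of "t + c"] by simp
  ultimately show "((\<lambda>t. V (t + c)) has_vector_derivative mode_field b r t (V (t + c))) (at t)"
    by (rule vector_diff_chain_at[of "\<lambda>t. t + c" 1 t V, unfolded o_def scaleR_one])
qed

text \<open>The description operator in the definition of the fundamental solution is legitimate since its
columns are the uniquely determined solutions starting at the unit vectors. From here on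
the fundamental solution enters only through this property: it transports the values of solutions.\<close>
lemma fundamental_solution_apply:
  assumes V: "mode_solution b (norm \<xi>) V"
  shows "fundamental_solution b t s \<xi> *v V s = V t"
proof -
  have "\<exists>\<Phi>. mode_solution b (norm \<xi>) \<Phi> \<and> \<Phi> s = axis j 1" for j :: 2
    by (rule mode_solution_exists[of "norm \<xi>" s "axis j 1"]) blast
  then obtain \<Phi> where \<Phi>: "\<And>j. mode_solution b (norm \<xi>) (\<Phi> j)" "\<And>j. \<Phi> j s = axis (j::2) 1"
    by metis
  define X where "X t = (\<chi> i j. \<Phi> j t $ i)" for t
  have col: "column j (X t) = \<Phi> j t" for j t by (simp add: X_def column_def vec_eq_iff)
  have X: "is_fundamental_solution b s \<xi> X"
    by (simp add: is_fundamental_solution_iff_columns col \<Phi>)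
  have "Y = X" if "is_fundamental_solution b s \<xi> Y" for Y
  proof
    fix t
    have "column j (Y t) = column j (X t)" for j
      using that X unfolding is_fundamental_solution_iff_columns
      by (intro mode_solution_unique[of "norm \<xi>" "\<lambda>t. column j (Y t)" "\<lambda>t. column j (X t)" s t]) auto
    then show "Y t = X t" by (simp add: vec_eq_iff column_def)
  qed
  with X have THE: "fundamental_solution b t s \<xi> = X t"
    unfolding fundamental_solution_def by (metis (mono_tags, lifting) the_equality)
  define W where "W t = V s $ 1 *s \<Phi> 1 t + V s $ 2 *s \<Phi> 2 t" for t
  have "mode_solution b (norm \<xi>) W"
    unfolding W_def by (intro mode_solution_add mode_solution_scale \<Phi>)
  moreover have "W s = V s"
    by (simp add: W_def \<Phi> vec_eq_iff forall_2 axis_def)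
  ultimately have "W t = V t" by (rule mode_solution_unique[OF _ V])
  moreover have "X t *v V s = W t"
    by (simp add: W_def X_def matrix_vector_mult_def vec_eq_iff sum_2 mult.commute)
  ultimately show ?thesis by (simp only: THE)
qed

lemma monodromy_apply:
  "mode_solution b (norm \<xi>) V \<Longrightarrow> monodromy b T t \<xi> *v V t = V (t + T)"
  unfolding monodromy_def by (rule fundamental_solution_apply)

section \<open>Dissipation of energy and contraction\<close>

text \<open>The oscillating part \<open>\<i> r\<close> of the system is skew-Hermitian and conserves the energy, so only the
dissipation contributes, and it acts on the second component alone.\<close>
lemma energy_deriv:
  assumes V: "mode_solution b r V"
  shows "((\<lambda>t. (norm (V t))\<^sup>2) has_real_derivative - 4 * b t * (norm (V t $ 2))\<^sup>2) (at t)"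
proof -
  have "((\<lambda>t. V t \<bullet> V t) has_real_derivative 2 * (V t \<bullet> mode_field b r t (V t))) (at t)"
    unfolding has_real_derivative_iff_has_vector_derivative has_vector_derivative_def
    using has_derivative_inner[OF V[unfolded mode_solution_def has_vector_derivative_def, rule_format]
        V[unfolded mode_solution_def has_vector_derivative_def, rule_format], of t]
    by (simp add: inner_commute algebra_simps)
  moreover have "V t \<bullet> mode_field b r t (V t) = - 2 * b t * (norm (V t $ 2))\<^sup>2"
    unfolding inner_vec_def sum_2 mode_field_nth cmod_power2
    by (simp add: inner_complex_def algebra_simps power2_eq_square)
  ultimately show ?thesis by (simp add: dot_square_norm mult.assoc)
qed

lemma energy_antimono:
  assumes V: "mode_solution b r V" and "s \<le> t"
  shows "norm (V t) \<le> norm (V s)"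
proof -
  have "(norm (V t))\<^sup>2 \<le> (norm (V s))\<^sup>2"
  proof (rule DERIV_nonpos_imp_nonincreasing[OF \<open>s \<le> t\<close>])
    fix u show "\<exists>y. DERIV (\<lambda>t. (norm (V t))\<^sup>2) u :> y \<and> y \<le> 0"
      using energy_deriv[OF V, of u] b_nonneg[of u] by (intro exI conjI) auto
  qed
  then show ?thesis by (rule power2_le_imp_le) simp
qed

text \<open>If no energy were lost over a period, the second component would vanish on an open set of times where
\<open>b > 0\<close>. Its derivative then vanishes there too, and the second equation forces \<open>r V\<^sub>1 = 0\<close>. So a
solution without loss vanishes at some time, whereas its energy is that of \<open>V s \<noteq> 0\<close>.\<close>
lemma energy_strict_decay:
  assumes V: "mode_solution b r V" and "r \<noteq> 0" and nz: "V s \<noteq> 0"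
  shows "norm (V (s + T)) < norm (V s)"
proof (rule ccontr)
  assume "\<not> ?thesis"
  then have const: "norm (V u) = norm (V s)" if "u \<in> {s<..<s + T}" for u
    using that energy_antimono[OF V, of s u] energy_antimono[OF V, of u "s + T"] by auto
  let ?S = "{s<..<s + T} \<inter> {u. 0 < b u}"
  have "open ?S" using cont by (intro open_Int open_Collect_less) auto
  obtain u where u: "u \<in> ?S"
    using exists_pos_in_open[of "{s<..<s + T}"] T_pos by auto
  have V2: "V w $ 2 = 0" if "w \<in> ?S" for w
  proof -
    have "((\<lambda>t. (norm (V t))\<^sup>2) has_real_derivative 0) (at w)"
      by (rule has_field_derivative_transform_within_open[OF DERIV_const[of "(norm (V s))\<^sup>2"],
            where S = "{s<..<s + T}"]) (use that const in auto)
    then have "4 * b w * (norm (V w $ 2))\<^sup>2 = 0"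
      using DERIV_unique[OF energy_deriv[OF V, of w], of 0] by simp
    then show ?thesis using that by simp
  qed
  have "((\<lambda>t. V t $ 2) has_vector_derivative 0) (at u)"
    by (rule has_vector_derivative_transform_within_open[OF has_vector_derivative_const[of 0] \<open>open ?S\<close> u])
      (use V2 in auto)
  then have "\<i> * complex_of_real r * V u $ 1 - 2 * complex_of_real (b u) * V u $ 2 = 0"
    using vector_derivative_unique_at[OF mode_solution_nth(2)[OF V, of u]] by blast
  then have "V u $ 1 = 0" using V2[OF u] \<open>r \<noteq> 0\<close> by simp
  then have "V u = 0" using V2[OF u] by (simp add: vec_eq_iff forall_2)
  moreover have "norm (V u) = norm (V s)" using const u by simp
  ultimately show False using nz by simp
qed

text \<open>Compactness turns the strict decay into a uniform factor: the ratio of the energies at \<open>t + T\<close> and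
\<open>t\<close> depends continuously on \<open>t\<close> and on the initial value at time \<open>0\<close>. By periodicity \<open>t\<close> may be
confined to one period, and by homogeneity the initial value to the unit sphere.\<close>
lemma uniform_energy_decay:
  assumes "r \<noteq> 0"
  obtains q where "0 \<le> q" "q < 1"
    "\<And>V t. mode_solution b r V \<Longrightarrow> norm (V (t + T)) \<le> q * norm (V t)"
proof -
  obtain \<Phi> where \<Phi>: "mode_solution b r \<Phi>" "\<Phi> 0 = axis 1 1" by (rule mode_solution_exists)
  obtain \<Psi> where \<Psi>: "mode_solution b r \<Psi>" "\<Psi> 0 = axis 2 1" by (rule mode_solution_exists)
  define W where "W v t = v $ 1 *s \<Phi> t + v $ 2 *s \<Psi> t" for v :: "complex^2" and t
  have W: "mode_solution b r (W v)" for v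
    unfolding W_def by (intro mode_solution_add mode_solution_scale \<Phi> \<Psi>)
  have W0: "W v 0 = v" for v by (simp add: W_def \<Phi> \<Psi> vec_eq_iff forall_2 axis_def)
  have W_nz: "W v t \<noteq> 0" if "v \<noteq> 0" for v t
  proof
    assume "W v t = 0"
    moreover have "mode_solution b r (\<lambda>_. 0)"
      by (simp add: mode_solution_def linear_0[OF linear_mode_field])
    ultimately have "W v 0 = 0" using mode_solution_unique[OF W[of v], of "\<lambda>_. 0" t 0] by simp
    with that show False by (simp add: W0)
  qed
  have cont_W: "continuous_on UNIV (\<lambda>(t, v). W v t)"
  proof -
    have "continuous_on UNIV (\<lambda>p::real \<times> (complex^2). \<Phi> (fst p))"
      "continuous_on UNIV (\<lambda>p::real \<times> (complex^2). \<Psi> (fst p))"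
      using mode_solution_continuous[OF \<Phi>(1)] mode_solution_continuous[OF \<Psi>(1)]
      by (auto intro!: continuous_on_compose2[of UNIV _ UNIV fst] continuous_intros)
    then show ?thesis unfolding W_def case_prod_beta vector_scalar_mult_def
      by (auto intro!: continuous_intros)
  qed
  let ?K = "{0..T} \<times> sphere (0 :: complex^2) 1"
  define \<rho> where "\<rho> = (\<lambda>(t, v). norm (W v (t + T)) / norm (W v t))"
  have "continuous_on ?K \<rho>"
    unfolding \<rho>_def case_prod_beta
  proof (intro continuous_on_divide continuous_on_norm)
    show "continuous_on ?K (\<lambda>p. W (snd p) (fst p + T))"
    proof -
      have "continuous_on ?K (\<lambda>p. (fst p + T, snd p))" by (intro continuous_intros)
      from continuous_on_compose2[OF cont_W this] show ?thesis by simp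
    qed
    show "continuous_on ?K (\<lambda>p. W (snd p) (fst p))"
      using continuous_on_subset[OF cont_W] by (simp add: case_prod_beta)
    have "W v t \<noteq> 0" if "norm v = 1" for t v using that W_nz[of v t] by force
    then show "\<forall>p\<in>?K. norm (W (snd p) (fst p)) \<noteq> 0" by auto
  qed
  moreover have "compact ?K" by (intro compact_Times) auto
  moreover have "?K \<noteq> {}" using T_pos by auto
  ultimately obtain p where p: "p \<in> ?K" "\<And>x. x \<in> ?K \<Longrightarrow> \<rho> x \<le> \<rho> p"
    using continuous_attains_sup[of ?K \<rho>] by blast
  have "\<rho> p < 1"
  proof -
    obtain t v where tv: "p = (t, v)" "norm v = 1" using p(1) by (cases p) auto
    then have "W v t \<noteq> 0" by (intro W_nz) auto
    with energy_strict_decay[OF W \<open>r \<noteq> 0\<close> this] show ?thesis by (simp add: \<rho>_def tv)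
  qed
  moreover have "0 \<le> \<rho> p" by (auto simp: \<rho>_def split: prod.split)
  moreover have "norm (V (t + T)) \<le> \<rho> p * norm (V t)" if V: "mode_solution b r V" for V t
  proof -
    \<comment> \<open>Solutions may be shifted by a period in both directions, so the claim is periodic in \<open>t\<close>.\<close>
    define P where "P t \<longleftrightarrow> (\<forall>V. mode_solution b r V \<longrightarrow> norm (V (t + T)) \<le> \<rho> p * norm (V t))" for t
    have "P (t + T) = P t" for t
    proof
      assume *: "P (t + T)"
      have "norm (V (t + T)) \<le> \<rho> p * norm (V t)" if "mode_solution b r V" for V
        using *[unfolded P_def, rule_format, OF mode_solution_shift[OF that, of "- T"]]
          periodic[of "s - T" for s] by (simp add: add.commute)
      then show "P t" by (simp add: P_def)
    next
      assume *: "P t"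
      then show "P (t + T)"
        using mode_solution_shift[OF _ periodic] unfolding P_def by blast
    qed
    then obtain t' where t': "t' \<in> {0..T}" "P t = P t'"
      by (rule periodic_reduce)
    have "P t'"
      unfolding P_def
    proof (intro allI impI)
      fix U assume U: "mode_solution b r U"
      define n where "n = norm (U 0)"
      have UW: "U s = n *\<^sub>R W ((1 / n) *\<^sub>R U 0) s" if "U 0 \<noteq> 0" for s
      proof -
        have "U s = W (U 0) s" by (rule mode_solution_unique[OF U W[of "U 0"], of 0]) (simp add: W0)
        also have "\<dots> = n *\<^sub>R W ((1 / n) *\<^sub>R U 0) s"
          using that by (simp add: W_def n_def vec_eq_iff forall_2 algebra_simps)
        finally show ?thesis .
      qed
      show "norm (U (t' + T)) \<le> \<rho> p * norm (U t')"
      proof (cases "U 0 = 0")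
        case True
        then have "U s = 0" for s
          using mode_solution_unique[OF U W[of 0], of 0 s] by (simp add: W0 W_def)
        then show ?thesis by simp
      next
        case False
        let ?u = "(1 / n) *\<^sub>R U 0"
        have u: "norm ?u = 1" using False by (simp add: n_def)
        have "\<rho> (t', ?u) \<le> \<rho> p" using t' u by (intro p(2)) auto
        moreover have "W ?u t' \<noteq> 0" using u by (intro W_nz) auto
        ultimately have "norm (W ?u (t' + T)) \<le> \<rho> p * norm (W ?u t')"
          by (simp add: \<rho>_def pos_divide_le_eq)
        then have "n * norm (W ?u (t' + T)) \<le> n * (\<rho> p * norm (W ?u t'))"
          by (intro mult_left_mono) (simp_all add: n_def)
        then show ?thesis
          unfolding UW[OF False, of "t' + T"] UW[OF False, of t'] norm_scaleR
          by (simp add: n_def mult_ac)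
      qed
    qed
    with t' V show ?thesis by (simp add: P_def)
  qed
  ultimately show ?thesis using that by blast
qed

lemma monodromy_contraction:
  fixes \<xi> :: "real^'n"
  assumes "\<xi> \<noteq> 0"
  shows "uniform_contraction (\<lambda>t. monodromy b T t \<xi>)"
proof -
  have "norm \<xi> \<noteq> 0" using assms by simp
  then obtain q where q: "0 \<le> q" "q < 1"
    "\<And>V t. mode_solution b (norm \<xi>) V \<Longrightarrow> norm (V (t + T)) \<le> q * norm (V t)"
    by (rule uniform_energy_decay) blast
  have le: "op_norm (monodromy b T t \<xi>) \<le> q" for t
    unfolding op_norm_def
  proof (rule onorm_bound[OF q(1)])
    fix v
    obtain V where V: "mode_solution b (norm \<xi>) V" "V t = v" by (rule mode_solution_exists)
    show "norm (monodromy b T t \<xi> *v v) \<le> q * norm v"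
      using q(3)[OF V(1), of t] monodromy_apply[OF V(1), of t] V(2) by simp
  qed
  then have "bdd_above (range (\<lambda>t. op_norm (monodromy b T t \<xi>)))" by (intro bdd_aboveI2)
  moreover have "(SUP t. op_norm (monodromy b T t \<xi>)) \<le> q" by (rule cSUP_least) (auto simp: le)
  ultimately show ?thesis using q(2) by (simp add: uniform_contraction_def)
qed

end

section \<open>Trace and determinant of the monodromy matrix at low frequencies\<close>

lemma norm_increment_le:
  fixes f :: "real \<Rightarrow> 'a::real_normed_vector"
  assumes f: "\<And>t. (f has_vector_derivative f' t) (at t)"
    and bound: "\<And>t. t \<in> {0..T} \<Longrightarrow> norm (f' t) \<le> K"
    and t: "t \<in> {0..T}"
  shows "norm (f t - f 0) \<le> K * T"
proof -
  have "0 \<le> K" using bound[OF t] norm_ge_zero order_trans by blast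
  have "norm (f t - f 0) \<le> K * t - K * 0" if "t > 0"
  proof (rule differentiable_bound_general[OF that _ _ f, of "\<lambda>t. K * t" "\<lambda>_. K"])
    show "((\<lambda>t. K * t) has_vector_derivative K) (at u)" for u
      unfolding has_real_derivative_iff_has_vector_derivative[symmetric]
      by (auto intro!: derivative_eq_intros)
  qed (use bound t has_vector_derivative_continuous_on[OF f] in \<open>auto intro!: continuous_intros\<close>)
  then have "norm (f t - f 0) \<le> K * t" using t by (cases "t > 0") auto
  also have "\<dots> \<le> K * T" using t \<open>0 \<le> K\<close> by (intro mult_left_mono) auto
  finally show ?thesis .
qed

text \<open>An approximation of \<open>F\<close> is converted into an approximation of an antiderivative \<open>f\<close> that is better by one
power of \<open>r\<close>. Used alternately for the two components of a mode, each application
adds the next term of the expansion in \<open>r\<close>.\<close>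
lemma picard_refinement:
  fixes f P F Q :: "real \<Rightarrow> complex" and g :: "real \<Rightarrow> real"
  assumes f: "\<And>t. (f has_vector_derivative \<i> * of_real r * of_real (g t) * F t) (at t)"
    and P: "\<And>t. (P has_vector_derivative \<i> * of_real r * of_real (g t) * Q t) (at t)"
    and init: "f 0 = P 0" and "r \<ge> 0"
    and g: "\<And>t. t \<in> {0..T} \<Longrightarrow> 0 \<le> g t \<and> g t \<le> K"
    and close: "\<And>t. t \<in> {0..T} \<Longrightarrow> norm (F t - Q t) \<le> k"
    and t: "t \<in> {0..T}"
  shows "norm (f t - P t) \<le> r * K * k * T"
proof -
  have deriv: "((\<lambda>t. f t - P t) has_vector_derivative \<i> * of_real r * of_real (g t) * (F t - Q t)) (at t)"
    for t using has_vector_derivative_diff[OF f P] by (simp add: right_diff_distrib)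
  have "norm (\<i> * of_real r * of_real (g t) * (F t - Q t)) \<le> r * K * k" if "t \<in> {0..T}" for t
  proof -
    have "norm (\<i> * of_real r * of_real (g t) * (F t - Q t)) = r * g t * norm (F t - Q t)"
      using g[OF that] \<open>r \<ge> 0\<close> by (simp add: norm_mult)
    also have "\<dots> \<le> r * K * k"
      using g[OF that] close[OF that] \<open>r \<ge> 0\<close> by (intro mult_mono) auto
    finally show ?thesis .
  qed
  from norm_increment_le[OF deriv this t] show ?thesis by (simp add: init)
qed

context periodic_dissipation
begin

text \<open>Multiplying the second component by \<open>exp (2 B)\<close> removes the dissipative term, which leaves a pair of
equations in which either component is an integral of the other times \<open>r\<close>.\<close>
lemma integrating_factor:
  assumes V: "mode_solution b r V" and B: "\<And>t. (B has_real_derivative b t) (at t)"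
  shows "((\<lambda>t. of_real (exp (2 * B t)) * V t $ 2) has_vector_derivative
           \<i> * of_real r * of_real (exp (2 * B t)) * V t $ 1) (at t)"
proof -
  have "((\<lambda>t. exp (2 * B t)) has_real_derivative exp (2 * B t) * (2 * b t)) (at t)"
    by (auto intro!: derivative_eq_intros B)
  from has_vector_derivative_mult[OF has_vector_derivative_of_real[OF this] mode_solution_nth(2)[OF V]]
  show ?thesis by (rule has_vector_derivative_eq_rhs) (simp add: algebra_simps)
qed

lemma antiderivative_mono:
  assumes B: "\<And>t. (B has_real_derivative b t) (at t)" and "s \<le> t"
  shows "B s \<le> B t"
  using \<open>s \<le> t\<close> by (rule DERIV_nonneg_imp_nondecreasing) (use B b_nonneg in blast)

lemma antiderivative_period_pos:
  assumes B: "\<And>t. (B has_real_derivative b t) (at t)"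
  shows "B 0 < B T"
proof (rule ccontr)
  assume "\<not> B 0 < B T"
  then have const: "B t = B 0" if "t \<in> {0<..<T}" for t
    using that antiderivative_mono[OF B, of 0 t] antiderivative_mono[OF B, of t T] by auto
  obtain t where t: "t \<in> {0<..<T}" "b t > 0"
    using exists_pos_in_open[of "{0<..<T}"] T_pos by auto
  have "(B has_real_derivative 0) (at t)"
    by (rule has_field_derivative_transform_within_open[OF DERIV_const[of "B 0"], where S = "{0<..<T}"])
      (use t const in auto)
  then show False using DERIV_unique[OF B] t(2) by force
qed

text \<open>With the pair \<open>x = V\<^sub>1\<close>, \<open>w = exp (2 B) V\<^sub>2\<close> one has \<open>x' = \<i> r exp (-2 B) w\<close> and
\<open>w' = \<i> r exp (2 B) x\<close>. The functions \<open>G\<close> and \<open>H\<close> are the iterated integrals that occur as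
coefficients of the solutions starting with \<open>x = 1\<close>, \<open>w = 0\<close> and with \<open>x = 0\<close>, \<open>w = 1\<close>,
respectively. Starting from the bound that the energy provides, four refinements reach the
error \<open>r\<^sup>4\<close>.\<close>
lemma diagonal_entries_expansion:
  assumes B: "B 0 = 0" "\<And>t. (B has_real_derivative b t) (at t)"
    and G: "G\<^sub>1 0 = 0" "\<And>t. (G\<^sub>1 has_real_derivative exp (2 * B t)) (at t)"
      "G\<^sub>2 0 = 0" "\<And>t. (G\<^sub>2 has_real_derivative exp (- 2 * B t) * G\<^sub>1 t) (at t)"
    and H: "H\<^sub>1 0 = 0" "\<And>t. (H\<^sub>1 has_real_derivative exp (- 2 * B t)) (at t)"
      "H\<^sub>2 0 = 0" "\<And>t. (H\<^sub>2 has_real_derivative exp (2 * B t) * H\<^sub>1 t) (at t)"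
    and "r \<ge> 0"
  defines "D \<equiv> exp (2 * B T)"
  shows first_diagonal_entry_expansion:
      "mode_solution b r V \<Longrightarrow> V 0 = axis 1 1 \<Longrightarrow>
        norm (V T $ 1 - of_real (1 - r ^ 2 * G\<^sub>2 T)) \<le> D ^ 2 * T ^ 4 * r ^ 4"
    and second_diagonal_entry_expansion:
      "mode_solution b r V \<Longrightarrow> V 0 = axis 2 1 \<Longrightarrow>
        norm (V T $ 2 - of_real (exp (- 2 * B T) * (1 - r ^ 2 * H\<^sub>2 T))) \<le> D ^ 3 * T ^ 4 * r ^ 4"
proof -
  let ?m = "\<lambda>t. exp (- 2 * B t)" and ?e = "\<lambda>t. exp (2 * B t)"
  have m: "0 \<le> ?m t \<and> ?m t \<le> 1" and e: "0 \<le> ?e t \<and> ?e t \<le> D" if "t \<in> {0..T}" for t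
    using that antiderivative_mono[OF B(2), of t T] antiderivative_mono[OF B(2), of 0 t] B(1)
    by (auto simp: D_def)
  have T_mem: "T \<in> {0..T}" using T_pos by simp
  have me: "of_real (?m t) * (of_real (?e t) * z) = z" for t and z :: complex
    by (simp flip: mult.assoc of_real_mult exp_add)
  have x_deriv: "((\<lambda>t. V t $ 1) has_vector_derivative
      \<i> * of_real r * of_real (?m t) * (of_real (?e t) * V t $ 2)) (at t)"
    if "mode_solution b r V" for V t
    using mode_solution_nth(1)[OF that, of t] by (simp only: mult.assoc me)
  have V_le: "norm (V t $ i) \<le> 1" if "mode_solution b r V" "V 0 = axis j 1" "t \<in> {0..T}" for V t i j
  proof -
    have "norm (V t $ i) \<le> norm (V t)" by (rule Finite_Cartesian_Product.norm_nth_le)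
    also have "\<dots> \<le> norm (V 0)" using that by (intro energy_antimono) auto
    finally show ?thesis by (simp add: that(2))
  qed
  {
    assume V: "mode_solution b r V" "V 0 = axis 1 1"
    let ?x = "\<lambda>t. V t $ 1" and ?w = "\<lambda>t. of_real (?e t) * V t $ 2"
    have V0: "?x 0 = 1" "?w 0 = 0" by (simp_all add: V(2) axis_def)
    note w_deriv = integrating_factor[OF V(1) B(2)]
    have 1: "norm (?w t - 0) \<le> r * D * 1 * T" if "t \<in> {0..T}" for t
      using V0 V_le[OF V]
      by (intro picard_refinement[OF w_deriv _ _ \<open>r \<ge> 0\<close> e _ that, where P = "\<lambda>_. 0" and Q = "\<lambda>_. 0"]) auto
    have 2: "norm (?x t - 1) \<le> r * 1 * (r * D * 1 * T) * T" if "t \<in> {0..T}" for t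
      using V0 1
      by (intro picard_refinement[OF x_deriv[OF V(1)] _ _ \<open>r \<ge> 0\<close> m _ that, where P = "\<lambda>_. 1" and Q = "\<lambda>_. 0"]) auto
    have 3: "norm (?w t - \<i> * of_real r * of_real (G\<^sub>1 t)) \<le> r * D * (r * 1 * (r * D * 1 * T) * T) * T"
      if "t \<in> {0..T}" for t
    proof (rule picard_refinement[OF w_deriv _ _ \<open>r \<ge> 0\<close> e 2 that])
      show "((\<lambda>t. \<i> * of_real r * of_real (G\<^sub>1 t)) has_vector_derivative
          \<i> * of_real r * of_real (?e t) * 1) (at t)" for t
        using has_vector_derivative_mult_right[OF has_vector_derivative_of_real[OF G(2)], of "\<i> * of_real r"]
        by simp
    qed (use V0 G(1) in auto)
    have "norm (?x T - of_real (1 - r ^ 2 * G\<^sub>2 T))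
        \<le> r * 1 * (r * D * (r * 1 * (r * D * 1 * T) * T) * T) * T"
    proof (rule picard_refinement[OF x_deriv[OF V(1)] _ _ \<open>r \<ge> 0\<close> m 3 T_mem])
      have "((\<lambda>t. 1 - r ^ 2 * G\<^sub>2 t) has_real_derivative - (r ^ 2 * (?m t * G\<^sub>1 t))) (at t)" for t
        by (auto intro!: derivative_eq_intros G(4))
      from has_vector_derivative_of_real[OF this]
      show "((\<lambda>t. of_real (1 - r ^ 2 * G\<^sub>2 t)) has_vector_derivative
          \<i> * of_real r * of_real (?m t) * (\<i> * of_real r * of_real (G\<^sub>1 t))) (at t)" for t
        by (rule has_vector_derivative_eq_rhs) (simp add: power2_eq_square algebra_simps)
    qed (use V0 G(3) in auto)
    also have "\<dots> = D ^ 2 * T ^ 4 * r ^ 4" by (simp add: eval_nat_numeral)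
    finally show "norm (?x T - of_real (1 - r ^ 2 * G\<^sub>2 T)) \<le> D ^ 2 * T ^ 4 * r ^ 4" .
  }
  {
    assume V: "mode_solution b r V" "V 0 = axis 2 1"
    let ?x = "\<lambda>t. V t $ 1" and ?w = "\<lambda>t. of_real (?e t) * V t $ 2"
    have V0: "?x 0 = 0" "?w 0 = 1" by (simp_all add: V(2) axis_def B(1))
    note w_deriv = integrating_factor[OF V(1) B(2)]
    have 0: "norm (?w t - 0) \<le> D" if "t \<in> {0..T}" for t
    proof -
      have "norm (?w t - 0) = ?e t * norm (V t $ 2)" by (simp add: norm_mult)
      also have "\<dots> \<le> D * 1" using V_le[OF V that, of 2] e[OF that] by (intro mult_mono) (auto simp: D_def)
      finally show ?thesis by simp
    qed
    have 1: "norm (?x t - 0) \<le> r * 1 * D * T" if "t \<in> {0..T}" for t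
      using V0
      by (intro picard_refinement[OF x_deriv[OF V(1)] _ _ \<open>r \<ge> 0\<close> m 0 that, where P = "\<lambda>_. 0"]) auto
    have 2: "norm (?w t - 1) \<le> r * D * (r * 1 * D * T) * T" if "t \<in> {0..T}" for t
      using V0
      by (intro picard_refinement[OF w_deriv _ _ \<open>r \<ge> 0\<close> e 1 that, where P = "\<lambda>_. 1"]) auto
    have 3: "norm (?x t - \<i> * of_real r * of_real (H\<^sub>1 t)) \<le> r * 1 * (r * D * (r * 1 * D * T) * T) * T"
      if "t \<in> {0..T}" for t
    proof (rule picard_refinement[OF x_deriv[OF V(1)] _ _ \<open>r \<ge> 0\<close> m 2 that])
      show "((\<lambda>t. \<i> * of_real r * of_real (H\<^sub>1 t)) has_vector_derivative
          \<i> * of_real r * of_real (?m t) * 1) (at t)" for t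
        using has_vector_derivative_mult_right[OF has_vector_derivative_of_real[OF H(2)], of "\<i> * of_real r"]
        by simp
    qed (use V0 H(1) in auto)
    have w_T: "norm (?w T - of_real (1 - r ^ 2 * H\<^sub>2 T))
        \<le> r * D * (r * 1 * (r * D * (r * 1 * D * T) * T) * T) * T"
    proof (rule picard_refinement[OF w_deriv _ _ \<open>r \<ge> 0\<close> e 3 T_mem])
      have "((\<lambda>t. 1 - r ^ 2 * H\<^sub>2 t) has_real_derivative - (r ^ 2 * (?e t * H\<^sub>1 t))) (at t)" for t
        by (auto intro!: derivative_eq_intros H(4))
      from has_vector_derivative_of_real[OF this]
      show "((\<lambda>t. of_real (1 - r ^ 2 * H\<^sub>2 t)) has_vector_derivative
          \<i> * of_real r * of_real (?e t) * (\<i> * of_real r * of_real (H\<^sub>1 t))) (at t)" for t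
        by (rule has_vector_derivative_eq_rhs) (simp add: power2_eq_square algebra_simps)
    qed (use V0 H(3) in auto)
    have "V T $ 2 - of_real (?m T * (1 - r ^ 2 * H\<^sub>2 T))
        = of_real (?m T) * (?w T - of_real (1 - r ^ 2 * H\<^sub>2 T))"
      by (simp only: right_diff_distrib[of "complex_of_real (?m T)"] me of_real_mult)
    then have "norm (V T $ 2 - of_real (?m T * (1 - r ^ 2 * H\<^sub>2 T)))
        = ?m T * norm (?w T - of_real (1 - r ^ 2 * H\<^sub>2 T))"
      by (simp add: norm_mult)
    also have "\<dots> \<le> 1 * norm (?w T - of_real (1 - r ^ 2 * H\<^sub>2 T))"
      using m[OF T_mem] by (intro mult_right_mono) auto
    also have "\<dots> \<le> D ^ 3 * T ^ 4 * r ^ 4"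
      using w_T by (simp add: eval_nat_numeral mult_ac)
    finally show "norm (V T $ 2 - of_real (exp (- 2 * B T) * (1 - r ^ 2 * H\<^sub>2 T))) \<le> D ^ 3 * T ^ 4 * r ^ 4" .
  }
qed

lemma monodromy_entry:
  assumes "mode_solution b (norm \<xi>) V" "V t = axis j 1"
  shows "monodromy b T t \<xi> $ i $ j = V (t + T) $ i"
proof -
  have "monodromy b T t \<xi> $ i $ j = (monodromy b T t \<xi> *v axis j 1) $ i"
    by (simp add: matrix_vector_mult_def axis_def if_distrib cong: if_cong)
  then show ?thesis using monodromy_apply[OF assms(1), of t] by (simp add: assms(2))
qed

text \<open>The coefficient of \<open>\<bar>\<xi>\<bar>\<^sup>2\<close> is a sum of double integrals of positive functions, so it is
nonzero with a definite sign; this is where the positivity of \<open>\<alpha>\<^sub>2\<close> comes from.\<close>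
lemma trace_monodromy_expansion:
  assumes B: "B 0 = 0" "\<And>t. (B has_real_derivative b t) (at t)"
  shows "\<exists>a>0. \<exists>C. \<forall>\<xi>::real^'n.
    norm (trace (monodromy b T 0 \<xi>) - of_real (1 + exp (- 2 * B T) - a * norm \<xi> ^ 2)) \<le> C * norm \<xi> ^ 4"
proof -
  have primitive: "\<exists>F. F 0 = 0 \<and> (\<forall>t. (F has_real_derivative f t) (at t))"
    if "continuous_on UNIV f" for f :: "real \<Rightarrow> real"
    using antiderivative_exists[OF that, of 0]
    by (simp add: has_real_derivative_iff_has_vector_derivative)
  have cont_of_deriv: "continuous_on UNIV F" if "\<And>t. (F has_real_derivative f t) (at t)" for F f
    using that by (meson DERIV_continuous_on has_field_derivative_at_within)
  note cont = continuous_intros cont_of_deriv[OF B(2)]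
  obtain G\<^sub>1 where G1: "G\<^sub>1 0 = 0" "\<And>t. (G\<^sub>1 has_real_derivative exp (2 * B t)) (at t)"
  proof -
    have "continuous_on UNIV (\<lambda>t. exp (2 * B t))" by (intro cont)
    from primitive[OF this] that show ?thesis by blast
  qed
  obtain G\<^sub>2 where G2: "G\<^sub>2 0 = 0" "\<And>t. (G\<^sub>2 has_real_derivative exp (- 2 * B t) * G\<^sub>1 t) (at t)"
  proof -
    have "continuous_on UNIV (\<lambda>t. exp (- 2 * B t) * G\<^sub>1 t)" by (intro cont cont_of_deriv[OF G1(2)])
    from primitive[OF this] that show ?thesis by blast
  qed
  obtain H\<^sub>1 where H1: "H\<^sub>1 0 = 0" "\<And>t. (H\<^sub>1 has_real_derivative exp (- 2 * B t)) (at t)"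
  proof -
    have "continuous_on UNIV (\<lambda>t. exp (- 2 * B t))" by (intro cont)
    from primitive[OF this] that show ?thesis by blast
  qed
  obtain H\<^sub>2 where H2: "H\<^sub>2 0 = 0" "\<And>t. (H\<^sub>2 has_real_derivative exp (2 * B t) * H\<^sub>1 t) (at t)"
  proof -
    have "continuous_on UNIV (\<lambda>t. exp (2 * B t) * H\<^sub>1 t)" by (intro cont cont_of_deriv[OF H1(2)])
    from primitive[OF this] that show ?thesis by blast
  qed
  have increasing: "F 0 < F t" if "t > 0" "\<And>t. (F has_real_derivative f t) (at t)" "\<And>t. t > 0 \<Longrightarrow> f t > 0"
    for F f :: "real \<Rightarrow> real" and t
    using that(1)
  proof (rule DERIV_pos_imp_increasing_open)
    show "continuous_on {0..t} F" using cont_of_deriv[OF that(2)] continuous_on_subset by blast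
  qed (use that in blast)
  have "G\<^sub>1 t > 0" "H\<^sub>1 t > 0" if "t > 0" for t
    using increasing[OF that G1(2)] increasing[OF that H1(2)] G1(1) H1(1) by auto
  then have "G\<^sub>2 T > 0" "H\<^sub>2 T > 0"
    using increasing[OF T_pos G2(2)] increasing[OF T_pos H2(2)] G2(1) H2(1) by auto
  define a where "a = G\<^sub>2 T + exp (- 2 * B T) * H\<^sub>2 T"
  define D where "D = exp (2 * B T)"
  have "norm (trace (monodromy b T 0 \<xi>) - of_real (1 + exp (- 2 * B T) - a * norm \<xi> ^ 2))
      \<le> (D ^ 2 * T ^ 4 + D ^ 3 * T ^ 4) * norm \<xi> ^ 4" for \<xi> :: "real^'n"
  proof -
    let ?r = "norm \<xi>"
    obtain \<Phi> where \<Phi>: "mode_solution b ?r \<Phi>" "\<Phi> 0 = axis 1 1" by (rule mode_solution_exists)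
    obtain \<Psi> where \<Psi>: "mode_solution b ?r \<Psi>" "\<Psi> 0 = axis 2 1" by (rule mode_solution_exists)
    have "trace (monodromy b T 0 \<xi>) - of_real (1 + exp (- 2 * B T) - a * ?r ^ 2)
      = (\<Phi> T $ 1 - of_real (1 - ?r ^ 2 * G\<^sub>2 T))
        + (\<Psi> T $ 2 - of_real (exp (- 2 * B T) * (1 - ?r ^ 2 * H\<^sub>2 T)))"
      using monodromy_entry[OF \<Phi>] monodromy_entry[OF \<Psi>]
      by (simp add: trace_def sum_2 a_def algebra_simps)
    also have "norm \<dots> \<le> D ^ 2 * T ^ 4 * ?r ^ 4 + D ^ 3 * T ^ 4 * ?r ^ 4"
      unfolding D_def
      by (intro norm_triangle_mono first_diagonal_entry_expansion[OF B G1 G2 H1 H2 _ \<Phi>]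
          second_diagonal_entry_expansion[OF B G1 G2 H1 H2 _ \<Psi>]) simp_all
    finally show ?thesis by (simp add: algebra_simps)
  qed
  moreover have "a > 0" using \<open>G\<^sub>2 T > 0\<close> \<open>H\<^sub>2 T > 0\<close> by (simp add: a_def add_pos_pos)
  ultimately show ?thesis by blast
qed

text \<open>Liouville's formula: the Wronskian of two solutions, multiplied by the integrating factor, is constant.\<close>
lemma det_monodromy:
  assumes B: "B 0 = 0" "\<And>t. (B has_real_derivative b t) (at t)"
  shows "det (monodromy b T 0 \<xi>) = of_real (exp (- 2 * B T))"
proof -
  obtain \<Phi> where \<Phi>: "mode_solution b (norm \<xi>) \<Phi>" "\<Phi> 0 = axis 1 1" by (rule mode_solution_exists)
  obtain \<Psi> where \<Psi>: "mode_solution b (norm \<xi>) \<Psi>" "\<Psi> 0 = axis 2 1" by (rule mode_solution_exists)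
  define w where "w t = \<Phi> t $ 1 * (of_real (exp (2 * B t)) * \<Psi> t $ 2)
      - \<Psi> t $ 1 * (of_real (exp (2 * B t)) * \<Phi> t $ 2)" for t
  have "(w has_vector_derivative 0) (at t)" for t
    unfolding w_def
    using has_vector_derivative_diff[OF
        has_vector_derivative_mult[OF mode_solution_nth(1)[OF \<Phi>(1)] integrating_factor[OF \<Psi>(1) B(2)]]
        has_vector_derivative_mult[OF mode_solution_nth(1)[OF \<Psi>(1)] integrating_factor[OF \<Phi>(1) B(2)]]]
    by (rule has_vector_derivative_eq_rhs) (simp add: algebra_simps)
  then have "norm (w T - w 0) \<le> 0 * T"
    by (rule norm_increment_le) (use T_pos in auto)
  moreover have "w 0 = 1" by (simp add: w_def B(1) \<Phi>(2) \<Psi>(2) axis_def)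
  ultimately have "w T = 1" by simp
  have "det (monodromy b T 0 \<xi>) = \<Phi> T $ 1 * \<Psi> T $ 2 - \<Psi> T $ 1 * \<Phi> T $ 2"
    using monodromy_entry[OF \<Phi>] monodromy_entry[OF \<Psi>] by (simp add: det_2)
  also have "\<dots> = of_real (exp (- 2 * B T)) * of_real (exp (2 * B T)) * (\<Phi> T $ 1 * \<Psi> T $ 2 - \<Psi> T $ 1 * \<Phi> T $ 2)"
    by (simp flip: of_real_mult exp_add)
  also have "\<dots> = of_real (exp (- 2 * B T)) * w T"
    by (simp only: w_def right_diff_distrib mult_ac)
  finally show ?thesis by (simp add: \<open>w T = 1\<close>)
qed

text \<open>Floquet's description of the multipliers by quasi-periodic solutions does not mention the initial time
\<open>t\<close>. Hence the eigenvalues do not depend on it, and it suffices to compute them at time \<open>0\<close>.\<close>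
lemma eigenvalues_monodromy_floquet:
  "eigenvalues (monodromy b T t \<xi>) =
     {z. \<exists>V. mode_solution b (norm \<xi>) V \<and> (\<exists>s. V s \<noteq> 0) \<and> (\<forall>s. V (s + T) = z *s V s)}"
proof (intro set_eqI iffI)
  fix z assume "z \<in> eigenvalues (monodromy b T t \<xi>)"
  then obtain v where v: "v \<noteq> 0" "monodromy b T t \<xi> *v v = z *s v" by (auto simp: eigenvalues_def)
  obtain V where V: "mode_solution b (norm \<xi>) V" "V t = v" by (rule mode_solution_exists)
  have "V (t + T) = z *s V t" using monodromy_apply[OF V(1), of t] v(2) V(2) by simp
  then have "V (s + T) = z *s V s" for s
    by (rule mode_solution_unique[OF mode_solution_shift[OF V(1) periodic] mode_solution_scale[OF V(1)]])
  with V v(1) show "z \<in> {z. \<exists>V. mode_solution b (norm \<xi>) V \<and> (\<exists>s. V s \<noteq> 0) \<and> (\<forall>s. V (s + T) = z *s V s)}"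
    by auto
next
  fix z assume "z \<in> {z. \<exists>V. mode_solution b (norm \<xi>) V \<and> (\<exists>s. V s \<noteq> 0) \<and> (\<forall>s. V (s + T) = z *s V s)}"
  then obtain V s where V: "mode_solution b (norm \<xi>) V" "V s \<noteq> 0" "\<And>s. V (s + T) = z *s V s"
    by blast
  have "V t \<noteq> 0"
  proof
    assume "V t = 0"
    moreover have "mode_solution b (norm \<xi>) (\<lambda>_. 0)"
      by (simp add: mode_solution_def linear_0[OF linear_mode_field])
    ultimately have "V s = 0" using mode_solution_unique[OF V(1), of "\<lambda>_. 0" t s] by simp
    with V(2) show False ..
  qed
  then show "z \<in> eigenvalues (monodromy b T t \<xi>)"
    using monodromy_apply[OF V(1), of t] V(3)[of t] by (auto simp: eigenvalues_def)
qed

end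

section \<open>Eigenvalues of two-by-two matrices and their logarithms\<close>

lemma eigenvalues_2x2:
  "eigenvalues M = {z. z\<^sup>2 - trace M * z + det M = 0}"
proof (intro set_eqI)
  fix z
  have "mat z *v v = z *s v" for v :: "complex^2"
    by (simp add: vec_eq_iff forall_2 matrix_vector_mult_def sum_2 mat_def)
  then have "M *v v = z *s v \<longleftrightarrow> (M - mat z) *v v = 0" for v
    by (simp add: matrix_vector_mult_diff_rdistrib)
  then have "z \<in> eigenvalues M \<longleftrightarrow> \<not> (\<forall>v. (M - mat z) *v v = 0 \<longrightarrow> v = 0)"
    by (auto simp: eigenvalues_def)
  also have "\<dots> \<longleftrightarrow> \<not> invertible (M - mat z)"
    by (simp only: invertible_left_inverse matrix_left_invertible_ker)
  also have "\<dots> \<longleftrightarrow> det (M - mat z) = 0"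
    by (simp add: invertible_det_nz)
  also have "det (M - mat z) = z\<^sup>2 - trace M * z + det M"
    by (simp add: det_2 trace_def sum_2 mat_def power2_eq_square algebra_simps)
  finally show "z \<in> eigenvalues M \<longleftrightarrow> z \<in> {z. z\<^sup>2 - trace M * z + det M = 0}" by simp
qed

lemma monic_quadratic_roots:
  fixes \<tau> \<delta> :: complex
  shows "{z. z\<^sup>2 - \<tau> * z + \<delta> = 0}
    = {(\<tau> + csqrt (\<tau>\<^sup>2 - 4 * \<delta>)) / 2, (\<tau> - csqrt (\<tau>\<^sup>2 - 4 * \<delta>)) / 2}"
proof (intro set_eqI)
  fix z
  define s where "s = csqrt (\<tau>\<^sup>2 - 4 * \<delta>)"
  have "s\<^sup>2 = \<tau>\<^sup>2 - 4 * \<delta>" by (simp add: s_def)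
  then have "z\<^sup>2 - \<tau> * z + \<delta> = (z - (\<tau> + s) / 2) * (z - (\<tau> - s) / 2)"
    by (simp add: field_simps power2_eq_square)
  then show "z \<in> {z. z\<^sup>2 - \<tau> * z + \<delta> = 0} \<longleftrightarrow>
      z \<in> {(\<tau> + csqrt (\<tau>\<^sup>2 - 4 * \<delta>)) / 2, (\<tau> - csqrt (\<tau>\<^sup>2 - 4 * \<delta>)) / 2}"
    by (simp add: s_def)
qed

text \<open>The roots of \<open>z\<^sup>2 - \<tau> z + \<delta>\<close> with \<open>\<tau> = 1 + \<delta> - a \<bar>x\<bar>\<^sup>2 + O(\<bar>x\<bar>\<^sup>4)\<close> are perturbations of
\<open>1\<close> and \<open>\<delta>\<close>. Writing \<open>\<kappa>\<^sub>1 = 1 + h\<close> and \<open>w = \<tau> - 1 - \<delta>\<close>, the quadratic equation becomes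
\<open>h (\<kappa>\<^sub>1 - \<delta>) = w \<kappa>\<^sub>1\<close>. Since \<open>\<kappa>\<^sub>1 - \<delta>\<close> stays away from \<open>0\<close>, this gives \<open>h = O(w)\<close>
and then, inserted once more, \<open>h = w / (1 - \<delta>) + O(w\<^sup>2)\<close>; the logarithm of \<open>1 + h\<close> agrees with
\<open>h\<close> up to \<open>O(h\<^sup>2)\<close>. The other root is \<open>\<delta> / \<kappa>\<^sub>1\<close>.\<close>
lemma log_of_quadratic_roots_expansion:
  fixes \<tau> :: "'a::real_normed_vector \<Rightarrow> complex" and \<delta> a :: real
  assumes \<delta>: "0 < \<delta>" "\<delta> < 1"
    and bound: "\<And>x. norm (\<tau> x - of_real (1 + \<delta> - a * norm x ^ 2)) \<le> C * norm x ^ 4"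
  defines "\<kappa>\<^sub>1 \<equiv> \<lambda>x. (\<tau> x + csqrt ((\<tau> x)\<^sup>2 - 4 * of_real \<delta>)) / 2"
    and "\<kappa>\<^sub>2 \<equiv> \<lambda>x. (\<tau> x - csqrt ((\<tau> x)\<^sup>2 - 4 * of_real \<delta>)) / 2"
  shows "(\<lambda>x. Ln (\<kappa>\<^sub>1 x) - of_real (- (a / (1 - \<delta>)) * norm x ^ 2)) \<in> O[at 0](\<lambda>x. of_real (norm x ^ 4))"
    and "(\<lambda>x. Ln (\<kappa>\<^sub>2 x) - of_real (ln \<delta> + a / (1 - \<delta>) * norm x ^ 2)) \<in> O[at 0](\<lambda>x. of_real (norm x ^ 4))"
proof -
  define n2 n4 :: "'a \<Rightarrow> complex" where "n2 x = of_real (norm x ^ 2)" and "n4 x = of_real (norm x ^ 4)" for x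
  have n4: "n4 = (\<lambda>x. n2 x * n2 x)" by (rule ext) (simp add: n2_def n4_def flip: power_add)
  have n2_lim: "(n2 \<longlongrightarrow> 0) (at 0)"
    unfolding n2_def by (auto intro!: tendsto_eq_intros)
  have "n2 \<in> O[at 0](\<lambda>_. 1)" using bigoI_tendsto[of n2 "\<lambda>_. 1" 0 "at 0"] n2_lim by simp
  then have n4_n2: "n4 \<in> O[at 0](n2)"
    unfolding n4 using landau_o.big.mult[of n2 "at 0" "\<lambda>_. 1" n2 n2] by simp
  define w where "w x = \<tau> x - of_real (1 + \<delta>)" for x
  define s where "s x = csqrt ((\<tau> x)\<^sup>2 - 4 * of_real \<delta>)" for x
  have w1: "(\<lambda>x. w x + of_real a * n2 x) \<in> O[at 0](n4)"
    by (rule bigoI[of _ C], rule always_eventually)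
      (use bound in \<open>simp add: w_def n2_def n4_def norm_power algebra_simps\<close>)
  have w_n2: "w \<in> O[at 0](n2)"
  proof -
    have "(\<lambda>x. (w x + of_real a * n2 x) - of_real a * n2 x) \<in> O[at 0](n2)"
      by (intro sum_in_bigo landau_o.big.trans[OF w1 n4_n2]) simp
    then show ?thesis by simp
  qed
  have w_lim: "(w \<longlongrightarrow> 0) (at 0)"
  proof -
    obtain c where "\<forall>\<^sub>F x in at 0. norm (w x) \<le> c * norm (n2 x)"
      using w_n2 by (elim landau_o.bigE)
    then show ?thesis
      by (intro tendsto_0_le[OF n2_lim, of w c]) (simp add: mult.commute)
  qed
  have \<tau>_lim: "(\<tau> \<longlongrightarrow> of_real (1 + \<delta>)) (at 0)"
    using tendsto_add[OF w_lim tendsto_const[of "of_real (1 + \<delta>)"]] by (simp add: w_def)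
  have s_lim: "(s \<longlongrightarrow> of_real (1 - \<delta>)) (at 0)"
  proof -
    have sq: "(of_real (1 + \<delta>))\<^sup>2 - 4 * of_real \<delta> = (of_real ((1 - \<delta>)\<^sup>2) :: complex)"
      by (simp add: power2_eq_square algebra_simps)
    have "csqrt (of_real ((1 - \<delta>)\<^sup>2)) = of_real (1 - \<delta>)"
      using \<delta> by (subst csqrt_of_real_nonneg) auto
    moreover have "isCont csqrt (of_real ((1 - \<delta>)\<^sup>2))"
      using \<delta> by (intro continuous_at_csqrt) (auto simp: complex_nonpos_Reals_iff)
    moreover have "((\<lambda>x. (\<tau> x)\<^sup>2 - 4 * of_real \<delta>) \<longlongrightarrow> of_real ((1 - \<delta>)\<^sup>2)) (at 0)"
      unfolding sq[symmetric] by (intro tendsto_intros \<tau>_lim)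
    ultimately show ?thesis
      unfolding s_def by (metis isCont_tendsto_compose)
  qed
  define h where "h x = \<kappa>\<^sub>1 x - 1" for x
  have \<kappa>1_lim: "(\<kappa>\<^sub>1 \<longlongrightarrow> 1) (at 0)"
    using tendsto_divide[OF tendsto_add[OF \<tau>_lim s_lim] tendsto_const[of 2]]
    by (simp add: \<kappa>\<^sub>1_def s_def)
  have h_lim: "(h \<longlongrightarrow> 0) (at 0)"
    using tendsto_diff[OF \<kappa>1_lim tendsto_const[of 1]] by (simp add: h_def[abs_def])
  have prod: "\<kappa>\<^sub>1 x * \<kappa>\<^sub>2 x = of_real \<delta>" for x
  proof -
    have "(s x)\<^sup>2 = (\<tau> x)\<^sup>2 - 4 * of_real \<delta>" by (simp add: s_def)
    then show ?thesis
      by (simp add: \<kappa>\<^sub>1_def \<kappa>\<^sub>2_def flip: s_def) (simp add: power2_eq_square algebra_simps)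
  qed
  have sum: "\<kappa>\<^sub>1 x + \<kappa>\<^sub>2 x = \<tau> x" for x
    by (simp add: \<kappa>\<^sub>1_def \<kappa>\<^sub>2_def field_simps)
  have h_eq: "h x * (\<kappa>\<^sub>1 x - of_real \<delta>) = w x * \<kappa>\<^sub>1 x" for x
    unfolding h_def w_def sum[symmetric] using prod[of x] by (simp add: algebra_simps)
  have gap_lim: "((\<lambda>x. \<kappa>\<^sub>1 x - of_real \<delta>) \<longlongrightarrow> of_real (1 - \<delta>)) (at 0)"
    using tendsto_diff[OF \<kappa>1_lim tendsto_const[of "of_real \<delta>"]] by simp
  have gap_nz: "complex_of_real (1 - \<delta>) \<noteq> 0" using \<delta> by simp
  have ev_gap: "\<forall>\<^sub>F x in at 0. \<kappa>\<^sub>1 x - of_real \<delta> \<noteq> 0"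
    by (rule tendsto_imp_eventually_ne[OF gap_lim gap_nz])
  have ev_\<kappa>1: "\<forall>\<^sub>F x in at 0. \<kappa>\<^sub>1 x \<noteq> 0"
    by (rule tendsto_imp_eventually_ne[OF \<kappa>1_lim]) simp
  have inv_gap: "(\<lambda>x. 1 / (\<kappa>\<^sub>1 x - of_real \<delta>)) \<in> O[at 0](\<lambda>_. 1)"
    using bigoI_tendsto[OF _ , of "\<lambda>x. 1 / (\<kappa>\<^sub>1 x - of_real \<delta>)" "\<lambda>_. 1"]
      tendsto_divide[OF tendsto_const[of 1] gap_lim gap_nz] by simp
  have \<kappa>1_O1: "\<kappa>\<^sub>1 \<in> O[at 0](\<lambda>_. 1)"
    using bigoI_tendsto[of \<kappa>\<^sub>1 "\<lambda>_. 1" 1 "at 0"] \<kappa>1_lim by simp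
  have h_n2: "h \<in> O[at 0](n2)"
  proof -
    have "(\<lambda>x. w x * (\<kappa>\<^sub>1 x * (1 / (\<kappa>\<^sub>1 x - of_real \<delta>)))) \<in> O[at 0](\<lambda>x. n2 x * (1 * 1))"
      by (intro landau_o.big.mult w_n2 \<kappa>1_O1 inv_gap)
    moreover have ev: "\<forall>\<^sub>F x in at 0. w x * (\<kappa>\<^sub>1 x * (1 / (\<kappa>\<^sub>1 x - of_real \<delta>))) = h x"
      using ev_gap by eventually_elim (use h_eq in \<open>simp add: field_simps\<close>)
    ultimately have "h \<in> O[at 0](\<lambda>x. n2 x * (1 * 1))"
      by (simp only: landau_o.big.in_cong[OF ev])
    then show ?thesis by simp
  qed
  have h_first_order: "(\<lambda>x. h x - w x / of_real (1 - \<delta>)) \<in> O[at 0](n4)"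
  proof -
    have "(\<lambda>x. - (of_real \<delta> / of_real (1 - \<delta>)) * (w x * (h x * (1 / (\<kappa>\<^sub>1 x - of_real \<delta>)))))
        \<in> O[at 0](\<lambda>x. n2 x * (n2 x * 1))"
      by (intro landau_o.big.cmult_in_iff[THEN iffD2] landau_o.big.mult w_n2 h_n2 inv_gap)
        (use \<delta> in auto)
    moreover have ev: "\<forall>\<^sub>F x in at 0. - (of_real \<delta> / of_real (1 - \<delta>)) * (w x * (h x * (1 / (\<kappa>\<^sub>1 x - of_real \<delta>))))
        = h x - w x / of_real (1 - \<delta>)"
      using ev_gap
    proof eventually_elim
      case (elim x)
      have h: "h x = w x * \<kappa>\<^sub>1 x / (\<kappa>\<^sub>1 x - of_real \<delta>)"
        using h_eq[of x] elim by (simp add: field_simps)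
      have "h x - w x / of_real (1 - \<delta>)
          = w x * (\<kappa>\<^sub>1 x * of_real (1 - \<delta>) - (\<kappa>\<^sub>1 x - of_real \<delta>)) / ((\<kappa>\<^sub>1 x - of_real \<delta>) * of_real (1 - \<delta>))"
        unfolding h using elim gap_nz by (simp add: field_simps)
      also have "\<kappa>\<^sub>1 x * of_real (1 - \<delta>) - (\<kappa>\<^sub>1 x - of_real \<delta>) = - of_real \<delta> * h x"
        by (simp add: h_def algebra_simps)
      finally show ?case by (simp add: field_simps)
    qed
    ultimately have "(\<lambda>x. h x - w x / of_real (1 - \<delta>)) \<in> O[at 0](\<lambda>x. n2 x * (n2 x * 1))"
      by (simp only: landau_o.big.in_cong[OF ev])
    then show ?thesis unfolding n4 by simp
  qed
  have Ln_first_order: "(\<lambda>x. Ln (\<kappa>\<^sub>1 x) - h x) \<in> O[at 0](n4)"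
  proof -
    have "\<forall>\<^sub>F x in at 0. norm (h x) < 1 / 2"
      using tendstoD[OF h_lim, of "1 / 2"] by simp
    then have "\<forall>\<^sub>F x in at 0. norm (Ln (\<kappa>\<^sub>1 x) - h x) \<le> 2 * norm (h x * h x)"
    proof eventually_elim
      case (elim x)
      then have "norm (Ln (1 + h x) - h x) \<le> norm (h x) ^ 2 / (1 - norm (h x))"
        by (intro Ln_approx_linear) simp
      also have "\<dots> \<le> norm (h x) ^ 2 / (1 / 2)"
        using elim by (intro divide_left_mono) auto
      finally show ?case by (simp add: h_def norm_mult power2_eq_square)
    qed
    then have "(\<lambda>x. Ln (\<kappa>\<^sub>1 x) - h x) \<in> O[at 0](\<lambda>x. h x * h x)" by (rule bigoI)
    also have "(\<lambda>x. h x * h x) \<in> O[at 0](n4)"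
      unfolding n4 by (intro landau_o.big.mult h_n2)
    finally show ?thesis .
  qed
  have "(\<lambda>x. (Ln (\<kappa>\<^sub>1 x) - h x) + (h x - w x / of_real (1 - \<delta>))
      + 1 / of_real (1 - \<delta>) * (w x + of_real a * n2 x)) \<in> O[at 0](n4)"
    by (intro sum_in_bigo Ln_first_order h_first_order landau_o.big.cmult_in_iff[THEN iffD2] w1)
      (use \<delta> in auto)
  also have "(\<lambda>x. (Ln (\<kappa>\<^sub>1 x) - h x) + (h x - w x / of_real (1 - \<delta>))
      + 1 / of_real (1 - \<delta>) * (w x + of_real a * n2 x))
      = (\<lambda>x. Ln (\<kappa>\<^sub>1 x) - of_real (- (a / (1 - \<delta>)) * norm x ^ 2))"
    by (intro ext) (simp add: n2_def add_divide_distrib)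
  finally show \<kappa>1: "(\<lambda>x. Ln (\<kappa>\<^sub>1 x) - of_real (- (a / (1 - \<delta>)) * norm x ^ 2)) \<in> O[at 0](\<lambda>x. of_real (norm x ^ 4))"
    by (simp only: n4_def[abs_def])
  have "\<forall>\<^sub>F x in at 0. \<kappa>\<^sub>1 x \<in> {z. 0 < Re z}"
    by (rule topological_tendstoD[OF \<kappa>1_lim open_halfspace_Re_gt]) simp
  \<comment> \<open>Near \<open>1\<close> the principal logarithm turns the quotient \<open>\<delta> / \<kappa>\<^sub>1\<close> into a difference.\<close>
  then have ev: "\<forall>\<^sub>F x in at 0. - (Ln (\<kappa>\<^sub>1 x) - of_real (- (a / (1 - \<delta>)) * norm x ^ 2))
      = Ln (\<kappa>\<^sub>2 x) - of_real (ln \<delta> + a / (1 - \<delta>) * norm x ^ 2)"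
  proof eventually_elim
    case (elim x)
    then have nz: "\<kappa>\<^sub>1 x \<noteq> 0" "\<kappa>\<^sub>1 x \<notin> \<real>\<^sub>\<le>\<^sub>0" by (auto simp: complex_nonpos_Reals_iff)
    then have "\<kappa>\<^sub>2 x = of_real \<delta> * inverse (\<kappa>\<^sub>1 x)"
      using prod[of x] by (simp add: field_simps)
    then have "Ln (\<kappa>\<^sub>2 x) = of_real (ln \<delta>) - Ln (\<kappa>\<^sub>1 x)"
      using nz \<delta> by (simp add: Ln_times_of_real Ln_inverse Ln_of_real)
    then show ?case by simp
  qed
  from \<kappa>1 show "(\<lambda>x. Ln (\<kappa>\<^sub>2 x) - of_real (ln \<delta> + a / (1 - \<delta>) * norm x ^ 2)) \<in> O[at 0](\<lambda>x. of_real (norm x ^ 4))"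
    by (subst landau_o.big.in_cong[OF ev, symmetric]) (simp only: landau_o.big.uminus_in_iff)
qed

section \<open>Contraction and asymptotics of the monodromy matrix\<close>

theorem theorem1p1:
  fixes b :: "real \<Rightarrow> real" and T \<beta> :: real
  assumes T_pos: "T > 0"
    and b_periodic: "\<And>t. b (t + T) = b t"
    and b_cont: "continuous_on UNIV b"
    and b_bv: "bounded_variation_on b 0 T"
    and b_pos: "AE t in lebesgue. b t > 0"
    and beta: "\<beta> = (1 / T) * integral {0..T} b"
  shows
    "(\<exists>N>0. \<forall>\<xi>::real^'n. norm \<xi> \<ge> N \<longrightarrow> uniform_contraction (\<lambda>t. monodromy b T t \<xi>))
     \<and>
     (\<forall>N>0. (\<forall>\<xi>::real^'n. norm \<xi> \<ge> N \<longrightarrow> uniform_contraction (\<lambda>t. monodromy b T t \<xi>)) \<longrightarrow>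
        (\<forall>c>0. \<exists>k\<ge>1. \<forall>\<xi>::real^'n. c \<le> norm \<xi> \<and> norm \<xi> \<le> N \<longrightarrow>
           uniform_contraction (\<lambda>t. mat_power (monodromy b T t \<xi>) k)))
     \<and>
     (\<exists>\<alpha>\<^sub>2>0. \<exists>\<kappa>\<^sub>1 \<kappa>\<^sub>2 :: real^'n \<Rightarrow> complex.
        (\<forall>\<xi> t. eigenvalues (monodromy b T t \<xi>) = {\<kappa>\<^sub>1 \<xi>, \<kappa>\<^sub>2 \<xi>}) \<and>
        (\<lambda>\<xi>. Ln (\<kappa>\<^sub>1 \<xi>) - complex_of_real (- \<alpha>\<^sub>2 * T * norm \<xi> ^ 2))
           \<in> O[at 0](\<lambda>\<xi>. complex_of_real (norm \<xi> ^ 4)) \<and>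
        (\<lambda>\<xi>. Ln (\<kappa>\<^sub>2 \<xi>) - complex_of_real (- 2 * \<beta> * T + \<alpha>\<^sub>2 * T * norm \<xi> ^ 2))
           \<in> O[at 0](\<lambda>\<xi>. complex_of_real (norm \<xi> ^ 4)))"
proof (intro conjI)
  interpret periodic_dissipation b T
    using T_pos b_periodic b_cont b_pos by unfold_locales
  show "\<exists>N>0. \<forall>\<xi>::real^'n. norm \<xi> \<ge> N \<longrightarrow> uniform_contraction (\<lambda>t. monodromy b T t \<xi>)"
    by (intro exI[of _ 1] conjI allI impI monodromy_contraction) auto
  have first_power: "mat_power M 1 = M" for M by simp
  show "\<forall>N>0. (\<forall>\<xi>::real^'n. norm \<xi> \<ge> N \<longrightarrow> uniform_contraction (\<lambda>t. monodromy b T t \<xi>)) \<longrightarrow>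
      (\<forall>c>0. \<exists>k\<ge>1. \<forall>\<xi>::real^'n. c \<le> norm \<xi> \<and> norm \<xi> \<le> N \<longrightarrow>
        uniform_contraction (\<lambda>t. mat_power (monodromy b T t \<xi>) k))"
  proof (intro allI impI exI[of _ "1::nat"] conjI)
    fix c :: real and \<xi> :: "real^'n" and N :: real
    assume "c > 0" "c \<le> norm \<xi> \<and> norm \<xi> \<le> N"
    then have "\<xi> \<noteq> 0" by auto
    then show "uniform_contraction (\<lambda>t. mat_power (monodromy b T t \<xi>) 1)"
      unfolding first_power by (rule monodromy_contraction)
  qed simp
  obtain B where B: "B 0 = 0" "\<And>t. (B has_real_derivative b t) (at t)"
    using antiderivative_exists[OF b_cont, of 0]
    by (auto simp: has_real_derivative_iff_has_vector_derivative)
  have "(b has_integral B T - B 0) {0..T}"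
    using B(2) T_pos
    by (intro fundamental_theorem_of_calculus)
      (auto simp: has_real_derivative_iff_has_vector_derivative intro: has_vector_derivative_at_within)
  then have B_T: "B T = \<beta> * T" using beta B(1) T_pos by (simp add: integral_unique)
  define \<delta> where "\<delta> = exp (- 2 * B T)"
  have \<delta>: "0 < \<delta>" "\<delta> < 1" "ln \<delta> = - 2 * \<beta> * T"
    using antiderivative_period_pos[OF B(2)] B(1) by (auto simp: \<delta>_def B_T)
  obtain a C where a: "a > 0"
    and trace: "\<And>\<xi>::real^'n. norm (trace (monodromy b T 0 \<xi>) - of_real (1 + \<delta> - a * norm \<xi> ^ 2))
      \<le> C * norm \<xi> ^ 4"
    using trace_monodromy_expansion[OF B] unfolding \<delta>_def by blast
  define \<tau> where "\<tau> \<xi> = trace (monodromy b T 0 \<xi>)" for \<xi> :: "real^'n"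
  define \<kappa>\<^sub>1 where "\<kappa>\<^sub>1 \<xi> = (\<tau> \<xi> + csqrt ((\<tau> \<xi>)\<^sup>2 - 4 * of_real \<delta>)) / 2" for \<xi>
  define \<kappa>\<^sub>2 where "\<kappa>\<^sub>2 \<xi> = (\<tau> \<xi> - csqrt ((\<tau> \<xi>)\<^sup>2 - 4 * of_real \<delta>)) / 2" for \<xi>
  have "eigenvalues (monodromy b T t \<xi>) = {\<kappa>\<^sub>1 \<xi>, \<kappa>\<^sub>2 \<xi>}" for t and \<xi> :: "real^'n"
  proof -
    have "eigenvalues (monodromy b T t \<xi>) = eigenvalues (monodromy b T 0 \<xi>)"
      by (simp only: eigenvalues_monodromy_floquet)
    also have "\<dots> = {z. z\<^sup>2 - \<tau> \<xi> * z + of_real \<delta> = 0}"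
      unfolding eigenvalues_2x2 \<tau>_def \<delta>_def det_monodromy[OF B] ..
    finally show ?thesis
      unfolding monic_quadratic_roots \<kappa>\<^sub>1_def \<kappa>\<^sub>2_def .
  qed
  moreover define \<alpha>\<^sub>2 where "\<alpha>\<^sub>2 = a / (T * (1 - \<delta>))"
  have "\<alpha>\<^sub>2 > 0" using a T_pos \<delta> by (simp add: \<alpha>\<^sub>2_def)
  moreover have \<alpha>: "a / (1 - \<delta>) = \<alpha>\<^sub>2 * T" using T_pos by (simp add: \<alpha>\<^sub>2_def)
  have "(\<lambda>\<xi>. Ln (\<kappa>\<^sub>1 \<xi>) - complex_of_real (- \<alpha>\<^sub>2 * T * norm \<xi> ^ 2))
      \<in> O[at 0](\<lambda>\<xi>. complex_of_real (norm \<xi> ^ 4))"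
    using log_of_quadratic_roots_expansion(1)[OF \<delta>(1,2) trace]
    unfolding \<alpha> \<kappa>\<^sub>1_def \<tau>_def by simp
  moreover have "(\<lambda>\<xi>. Ln (\<kappa>\<^sub>2 \<xi>) - complex_of_real (- 2 * \<beta> * T + \<alpha>\<^sub>2 * T * norm \<xi> ^ 2))
      \<in> O[at 0](\<lambda>\<xi>. complex_of_real (norm \<xi> ^ 4))"
    using log_of_quadratic_roots_expansion(2)[OF \<delta>(1,2) trace]
    unfolding \<alpha> \<delta>(3) \<kappa>\<^sub>2_def \<tau>_def by simp
  ultimately show "\<exists>\<alpha>\<^sub>2>0. \<exists>\<kappa>\<^sub>1 \<kappa>\<^sub>2 :: real^'n \<Rightarrow> complex.
      (\<forall>\<xi> t. eigenvalues (monodromy b T t \<xi>) = {\<kappa>\<^sub>1 \<xi>, \<kappa>\<^sub>2 \<xi>}) \<and>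
      (\<lambda>\<xi>. Ln (\<kappa>\<^sub>1 \<xi>) - complex_of_real (- \<alpha>\<^sub>2 * T * norm \<xi> ^ 2))
         \<in> O[at 0](\<lambda>\<xi>. complex_of_real (norm \<xi> ^ 4)) \<and>
      (\<lambda>\<xi>. Ln (\<kappa>\<^sub>2 \<xi>) - complex_of_real (- 2 * \<beta> * T + \<alpha>\<^sub>2 * T * norm \<xi> ^ 2))
         \<in> O[at 0](\<lambda>\<xi>. complex_of_real (norm \<xi> ^ 4))"
    by blast
qed

end
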